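(* Let $p$ be a prime, let $u \ge 0$ be an integer, and let $\alpha_n(1), \alpha_n(2), \ldots, \alpha_n(n+u) \in (0, 1/2]$ for every integer $n \ge 1$. Assume that for every $\epsilon>0$, $$\lim_{n \to \infty} \sum_{i=1}^{n+u} \exp \left( - \epsilon\, \alpha_n(i)\, n \right) = 0.$$ For each $n \ge 1$, let $A(n)$ be a random $n \times (n+u)$ matrix over $\mathbb{F}_p$ with independent entries such that the $i$-th column is $\alpha_n(i)$-balanced for every $1 \le i \le n+u$. Then for every nonnegative integer $k$, $$\lim_{n \to \infty} \mathbb{P}(\mathrm{rank}_{\mathbb{F}_p}(A(n)) = n-k) = p^{-k(k+u)} \frac{\prod_{j=1}^{\infty} (1-p^{-j})}{\prod_{j=1}^{k} (1-p^{-j}) \prod_{j=1}^{k+u} (1-p^{-j})}.$$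
   Context: $\mathbb{F}_p = \mathbb{Z}/p\mathbb{Z}$ is the field with $p$ elements. For $\alpha \in (0,1/2]$, a random variable $y$ with values in $\mathbb{F}_p$ is $\alpha$-balanced if $\mathbb{P}(y = r) \le 1-\alpha$ for every $r \in \mathbb{F}_p$. A random vector over $\mathbb{F}_p$ is $\alpha$-balanced if its entries are independent and each entry is $\alpha$-balanced (the entries need not be identically distributed). *)

theory Defs
  imports
    "HOL-Probability.Probability"
    "Berlekamp_Zassenhaus.Finite_Field"
    "Jordan_Normal_Form.DL_Rank"
begin

text \<open>
  The field with \<open>p\<close> elements is \<^typ>\<open>'p::prime_card mod_ring\<close> with \<open>p = CARD('p)\<close>:
  residues modulo \<open>CARD('p)\<close>, where the class \<^class>\<open>prime_card\<close> says that \<open>CARD('p)\<close> is prime.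
  Vectors and matrices are indexed from 0, so the \<open>i\<close>-th column (\<open>i \<ge> 1\<close>) of \<open>A\<close> is \<open>col A (i - 1)\<close>.
\<close>

definition balanced :: "real \<Rightarrow> 'w measure \<Rightarrow> ('w \<Rightarrow> 'p::prime_card mod_ring) \<Rightarrow> bool" where
  "balanced \<alpha> M y \<longleftrightarrow>
     y \<in> measurable M (count_space UNIV) \<and>
     (\<forall>r. \<P>(\<omega> in M. y \<omega> = r) \<le> 1 - \<alpha>)"

definition balanced_vec ::
  "real \<Rightarrow> 'w measure \<Rightarrow> nat \<Rightarrow> ('w \<Rightarrow> 'p::prime_card mod_ring vec) \<Rightarrow> bool" where
  "balanced_vec \<alpha> M n v \<longleftrightarrow>
     (\<forall>\<omega>\<in>space M. v \<omega> \<in> carrier_vec n) \<and>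
     prob_space.indep_vars M (\<lambda>_. count_space UNIV) (\<lambda>i \<omega>. v \<omega> $ i) {..<n} \<and>
     (\<forall>i<n. balanced \<alpha> M (\<lambda>\<omega>. v \<omega> $ i))"

definition indep_entries_mat ::
  "'w measure \<Rightarrow> nat \<Rightarrow> nat \<Rightarrow> ('w \<Rightarrow> 'p::prime_card mod_ring mat) \<Rightarrow> bool" where
  "indep_entries_mat M m n A \<longleftrightarrow>
     (\<forall>\<omega>\<in>space M. A \<omega> \<in> carrier_mat m n) \<and>
     prob_space.indep_vars M (\<lambda>_. count_space UNIV) (\<lambda>(i, j) \<omega>. A \<omega> $$ (i, j))
       ({..<m} \<times> {..<n})"

end

theory Submission
  imports Defs "HOL-Library.Function_Algebras"
begin

text \<open>
  The proof is by the method of moments, applied to the left kernel \<open>K\<close> of the random matrix. Its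
  cardinality is \<open>p ^ (n - rank)\<close>, so the corank is read off from it, and
  \<open>\<Prod>i<m. card K - p ^ i\<close> is the number of linearly independent \<open>m\<close>-tuples in \<open>K\<close>. The expectation
  of this number is a sum of probabilities \<open>kernel_prob fs\<close> over fixed tuples \<open>fs\<close>.

  Let \<open>V\<close> be the span of an independent \<open>m\<close>-tuple. By orthogonality of characters and independence,
  the probability that \<open>V\<close> lies in \<open>K\<close> is a product over the columns \<open>i\<close>
  of \<open>p ^ (- m) * (\<Sum>g\<in>V. column_cf i g)\<close>, where \<open>column_cf i\<close> is the characteristic function of
  column \<open>i\<close>. The vector \<open>0\<close> contributes \<open>p ^ (- m)\<close>, and an \<open>\<alpha>\<close>-balanced column
  makes the term of a vector of Hamming weight \<open>w\<close> at most \<open>exp (- c \<alpha> w)\<close> for a constant \<open>c > 0\<close>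
  depending on \<open>p\<close>. So if the nonzero vectors of \<open>V\<close> all have weight at least \<open>\<delta> n\<close>, the
  hypothesis on the \<open>\<alpha>\<close> makes the probability \<open>(1 + o(1)) p ^ (- m (n + u))\<close>, uniformly in the tuple
  (\<open>kernel_prob_near_uniform\<close>). For small \<open>\<delta>\<close> almost all tuples are of this kind, and together they
  contribute \<open>p ^ (- u m) + o(1)\<close>.

  The remaining tuples need not be estimated for each \<open>m\<close>: it suffices to discard the event that \<open>K\<close>
  contains a nonzero vector of weight below \<open>\<delta> n\<close>. Its probability tends to \<open>0\<close>
  (\<open>low_weight_mass_le\<close>): by the hypothesis at least \<open>n / 2\<close> columns have \<open>\<alpha>\<close> above a large multiple
  of \<open>ln n / n\<close>, which beats the number of vectors of each weight. Off this event every
  independent tuple in \<open>K\<close> is of the good kind. That the discarded event does not carry a positive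
  part of the moment is seen from pairs of a vector \<open>v\<close> of weight below \<open>\<delta> n\<close> and a tuple whose span
  has minimum weight \<open>2 \<delta> n\<close>: a combination that involves the tuple has weight at least \<open>\<delta> n\<close>, so up
  to a constant factor the probability that such a pair lies in \<open>K\<close> is at most \<open>p ^ (- m (n + u))\<close>
  times the bound used for \<open>v\<close> alone (\<open>kernel_prob_Cons_low_weight_le\<close>).

  The moments determine the law by a \<open>q\<close>-analogue of inclusion-exclusion. Its partial
  sums lie alternately above and below the probability of corank \<open>k\<close> (\<open>inversion_bounds\<close>), as in
  Bonferroni's inequalities; hence convergence of each single moment is enough, and
  the limit is the sum of an alternating series that Euler's product identity evaluates
  (\<open>inversion_sums\<close>).
\<close>

section \<open>Additive characters of the prime field and balanced variables\<close>

definition chi :: "'p::prime_card mod_ring \<Rightarrow> complex" where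
  "chi a = cis (2 * pi * of_int (to_int_mod_ring a) / real CARD('p))"

lemma CARD_ge_2: "CARD('p::prime_card) \<ge> 2"
  using prime_card prime_ge_2_nat by blast

lemma norm_chi [simp]: "norm (chi a) = 1"
  by (simp add: chi_def)

lemma chi_0 [simp]: "chi 0 = 1"
  by (simp add: chi_def)

text \<open>
  The argument of \<open>chi\<close> uses the integer representative, which is additive only up to multiples
  of \<open>p\<close>; these shift the angle by full turns.
\<close>

lemma chi_add: "chi (a + b) = chi a * chi (b :: 'p::prime_card mod_ring)"
proof -
  let ?p = "int CARD('p)"
  let ?s = "to_int_mod_ring a + to_int_mod_ring b"
  have p: "real CARD('p) \<noteq> 0"
    by simp
  have "real_of_int ?s = of_int (?s mod ?p) + real CARD('p) * of_int (?s div ?p)"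
    by (metis add.commute mult_div_mod_eq of_int_add of_int_mult of_int_of_nat_eq)
  hence "2 * pi * of_int ?s / real CARD('p)
      = 2 * pi * of_int (?s mod ?p) / real CARD('p) + 2 * pi * of_int (?s div ?p)"
    using p by (simp add: field_simps)
  moreover have "cis (2 * pi * of_int (?s div ?p)) = 1"
    by (simp add: complex_eq_iff)
  ultimately have "cis (2 * pi * of_int ?s / real CARD('p)) = chi (a + b)"
    by (simp add: chi_def to_int_mod_ring_add flip: cis_mult)
  thus ?thesis
    by (simp add: chi_def cis_mult add_divide_distrib distrib_left)
qed

lemma chi_sum: "chi (\<Sum>i\<in>I. f i) = (\<Prod>i\<in>I. chi (f i))"
  by (induction I rule: infinite_finite_induct) (simp_all add: chi_add)

lemma cnj_chi: "cnj (chi a) = chi (- a)"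
proof -
  have "chi a * chi (- a) = 1"
    by (simp flip: chi_add)
  moreover have "chi a * cnj (chi a) = 1"
    by (simp add: complex_norm_square [symmetric])
  moreover have "chi a \<noteq> 0"
    by (metis norm_chi norm_zero zero_neq_one)
  ultimately show ?thesis
    by (metis mult_cancel_left)
qed

text \<open>
  Among the nontrivial \<open>p\<close>-th roots of unity, the two neighbours of \<open>1\<close> have the largest real
  part.
\<close>

lemma Re_chi_le:
  assumes "a \<noteq> (0 :: 'p::prime_card mod_ring)"
  shows "Re (chi a) \<le> cos (2 * pi / real CARD('p))"
proof -
  define p where "p = real CARD('p)"
  define t where "t = to_int_mod_ring a"
  have "t \<in> {0..<int CARD('p)}"
    unfolding t_def using range_to_int_mod_ring by blast
  moreover have "t \<noteq> 0"
    using assms by (simp add: t_def)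
  ultimately have "1 \<le> t" "t \<le> int CARD('p) - 1"
    by auto
  hence t: "1 \<le> real_of_int t" "real_of_int t \<le> p - 1"
    unfolding p_def by linarith+
  have p: "p \<ge> 2"
    using CARD_ge_2 unfolding p_def by (metis of_nat_le_iff of_nat_numeral)
  show ?thesis
  proof (cases "2 * t \<le> p")
    case True
    hence "cos (2 * pi * t / p) \<le> cos (2 * pi / p)"
      using t p by (intro cos_monotone_0_pi_le) (auto simp: field_simps)
    thus ?thesis
      by (simp add: chi_def p_def t_def)
  next
    case False
    (* Reflect the angle into the upper half plane. *)
    have "cos (2 * pi * t / p) = cos (2 * pi - 2 * pi * t / p)"
      by (simp add: cos_diff)
    also have "2 * pi - 2 * pi * t / p = 2 * pi * (p - t) / p"
      using p by (simp add: field_simps)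
    also have "cos \<dots> \<le> cos (2 * pi / p)"
    proof (intro cos_monotone_0_pi_le)
      have "2 * pi * 1 / p \<le> 2 * pi * (p - t) / p"
        using t p by (intro divide_right_mono mult_left_mono) auto
      thus "2 * pi / p \<le> 2 * pi * (p - t) / p"
        by simp
      have "pi * (2 * (p - t)) \<le> pi * p"
        using False by (intro mult_left_mono) auto
      thus "2 * pi * (p - t) / p \<le> pi"
        using p by (simp add: field_simps)
    qed (use p in auto)
    finally show ?thesis
      by (simp add: chi_def p_def t_def)
  qed
qed

text \<open>
  Half of the smallest loss \<open>1 - Re (chi a)\<close> over all \<open>a \<noteq> 0\<close>, for \<open>p \<ge> 2\<close>.
\<close>

definition char_gap :: "nat \<Rightarrow> real" where
  "char_gap p = (1 - cos (2 * pi / real p)) / 2"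

lemma char_gap_pos: "p \<ge> 2 \<Longrightarrow> char_gap p > 0"
  using cos_monotone_0_pi[of 0 "2 * pi / real p"] by (simp add: char_gap_def field_simps)

lemma chi_eq_1_iff: "chi a = 1 \<longleftrightarrow> a = (0 :: 'p::prime_card mod_ring)"
proof
  assume *: "chi a = 1"
  show "a = 0"
  proof (rule ccontr)
    assume "a \<noteq> 0"
    from Re_chi_le[OF this] * char_gap_pos[OF CARD_ge_2[where 'p = 'p]] show False
      by (simp add: char_gap_def)
  qed
qed auto

text \<open>
  A permutation of \<open>V\<close> that shifts \<open>\<psi>\<close> by \<open>b\<close> multiplies the sum by \<open>chi b \<noteq> 1\<close>, so the sum
  vanishes.
\<close>

lemma sum_chi_shift:
  assumes "bij_betw \<tau> V V" and shift: "\<And>g. g \<in> V \<Longrightarrow> \<psi> (\<tau> g) = \<psi> g + b" and "b \<noteq> 0"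
  shows "(\<Sum>g\<in>V. chi (\<psi> g)) = 0"
proof -
  have "(\<Sum>g\<in>V. chi (\<psi> g)) = (\<Sum>g\<in>V. chi (\<psi> (\<tau> g)))"
    using sum.reindex_bij_betw[OF assms(1), of "\<lambda>g. chi (\<psi> g)"] by simp
  also have "\<dots> = chi b * (\<Sum>g\<in>V. chi (\<psi> g))"
    by (simp add: shift chi_add sum_distrib_left mult.commute)
  finally have "(1 - chi b) * (\<Sum>g\<in>V. chi (\<psi> g)) = 0"
    by (simp add: algebra_simps)
  thus ?thesis
    using assms(3) chi_eq_1_iff[of b] by auto
qed

lemma (in prob_space) expectation_finite_range:
  fixes x :: "'a \<Rightarrow> 'b::finite" and h :: "'b \<Rightarrow> complex"
  assumes [measurable]: "x \<in> measurable M (count_space UNIV)"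
  shows "integrable M (\<lambda>\<omega>. h (x \<omega>))"
    and "expectation (\<lambda>\<omega>. h (x \<omega>)) = (\<Sum>a\<in>UNIV. of_real (\<P>(\<omega> in M. x \<omega> = a)) * h a)"
proof -
  have eq: "h (x \<omega>) = (\<Sum>a\<in>UNIV. indicator {\<omega> \<in> space M. x \<omega> = a} \<omega> *\<^sub>R h a)"
    if "\<omega> \<in> space M" for \<omega>
  proof -
    have "(\<Sum>a\<in>UNIV. indicator {\<omega> \<in> space M. x \<omega> = a} \<omega> *\<^sub>R h a)
        = (\<Sum>a\<in>UNIV. if a = x \<omega> then h a else 0)"
      using that by (intro sum.cong) (auto simp: indicator_def)
    thus ?thesis by simp
  qed
  have [measurable]: "{\<omega> \<in> space M. x \<omega> = a} \<in> sets M" for a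
    by measurable
  have int: "integrable M (\<lambda>\<omega>. \<Sum>a\<in>UNIV. indicator {\<omega> \<in> space M. x \<omega> = a} \<omega> *\<^sub>R h a)"
    by (intro Bochner_Integration.integrable_sum integrable_scaleR_left integrable_real_indicator)
       (auto simp: emeasure_eq_measure)
  thus "integrable M (\<lambda>\<omega>. h (x \<omega>))"
    by (subst Bochner_Integration.integrable_cong[OF refl eq])
  have "expectation (\<lambda>\<omega>. h (x \<omega>))
      = expectation (\<lambda>\<omega>. \<Sum>a\<in>UNIV. indicator {\<omega> \<in> space M. x \<omega> = a} \<omega> *\<^sub>R h a)"
    by (intro Bochner_Integration.integral_cong eq refl)
  also have "\<dots> = (\<Sum>a\<in>UNIV. expectation (\<lambda>\<omega>. indicator {\<omega> \<in> space M. x \<omega> = a} \<omega> *\<^sub>R h a))"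
    by (intro Bochner_Integration.integral_sum integrable_scaleR_left integrable_real_indicator)
       (auto simp: emeasure_eq_measure)
  also have "\<dots> = (\<Sum>a\<in>UNIV. of_real (\<P>(\<omega> in M. x \<omega> = a)) * h a)"
  proof (intro sum.cong refl)
    fix a
    have "expectation (\<lambda>\<omega>. indicator {\<omega> \<in> space M. x \<omega> = a} \<omega> *\<^sub>R h a)
        = (expectation (indicator {\<omega> \<in> space M. x \<omega> = a}) :: real) *\<^sub>R h a"
      by (subst integral_scaleR_left)
         (auto intro!: integrable_real_indicator simp: emeasure_eq_measure)
    thus "expectation (\<lambda>\<omega>. indicator {\<omega> \<in> space M. x \<omega> = a} \<omega> *\<^sub>R h a)
        = of_real (\<P>(\<omega> in M. x \<omega> = a)) * h a"
      by (simp add: scaleR_conv_of_real)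
  qed
  finally show "expectation (\<lambda>\<omega>. h (x \<omega>)) = (\<Sum>a\<in>UNIV. of_real (\<P>(\<omega> in M. x \<omega> = a)) * h a)" .
qed

lemma (in prob_space) sum_prob_values:
  fixes x :: "'a \<Rightarrow> 'b::finite"
  assumes "x \<in> measurable M (count_space UNIV)"
  shows "(\<Sum>a\<in>UNIV. \<P>(\<omega> in M. x \<omega> = a)) = 1"
proof -
  have "complex_of_real (\<Sum>a\<in>UNIV. \<P>(\<omega> in M. x \<omega> = a)) = 1"
    using expectation_finite_range(2)[OF assms, of "\<lambda>_. 1"] by (simp add: prob_space)
  thus ?thesis
    using of_real_eq_1_iff by blast
qed

text \<open>
  The square of the modulus is \<open>\<Sum>a b. q a q b Re (chi (t (a - b)))\<close> with \<open>q\<close> the law of \<open>x\<close>. Off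
  the diagonal the real part is at most \<open>cos (2 pi / p)\<close>, and the diagonal has mass
  \<open>\<Sum>a. (q a)\<^sup>2 \<le> max q \<le> 1 - \<alpha>\<close>; so at least a fraction \<open>\<alpha>\<close> of the mass suffers the loss
  \<open>1 - cos (2 pi / p)\<close>.
\<close>

lemma (in prob_space) norm_expectation_chi_le:
  fixes x :: "'a \<Rightarrow> 'p::prime_card mod_ring"
  assumes bal: "balanced \<alpha> M x" and "t \<noteq> 0"
  shows "norm (expectation (\<lambda>\<omega>. chi (t * x \<omega>))) \<le> exp (- char_gap CARD('p) * \<alpha>)"
proof -
  define q where "q = (\<lambda>a. \<P>(\<omega> in M. x \<omega> = a))"
  define \<gamma> where "\<gamma> = cos (2 * pi / real CARD('p))"
  have meas: "x \<in> measurable M (count_space UNIV)" and le: "\<And>a. q a \<le> 1 - \<alpha>"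
    using bal by (auto simp: balanced_def q_def)
  have q0: "q a \<ge> 0" for a
    by (simp add: q_def)
  have q1: "(\<Sum>a\<in>UNIV. q a) = 1"
    unfolding q_def by (rule sum_prob_values[OF meas])
  define z where "z = expectation (\<lambda>\<omega>. chi (t * x \<omega>))"
  have z: "z = (\<Sum>a\<in>UNIV. of_real (q a) * chi (t * a))"
    unfolding z_def q_def by (rule expectation_finite_range(2)[OF meas])
  define S where "S = (\<Sum>a\<in>UNIV. q a ^ 2)"
  have "complex_of_real ((norm z)\<^sup>2) = z * cnj z"
    by (rule complex_norm_square)
  also have "\<dots> = (\<Sum>a\<in>UNIV. \<Sum>b\<in>UNIV. of_real (q a * q b) * chi (t * (a - b)))"
  proof -
    have "chi (t * a) * cnj (chi (t * b)) = chi (t * (a - b))" for a b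
      unfolding cnj_chi chi_add[symmetric] by (simp add: algebra_simps)
    thus ?thesis
      by (simp add: z sum_product mult_ac)
  qed
  finally have "(norm z)\<^sup>2 = Re (\<Sum>a\<in>UNIV. \<Sum>b\<in>UNIV. of_real (q a * q b) * chi (t * (a - b)))"
    by (metis Re_complex_of_real)
  also have "\<dots> = (\<Sum>a\<in>UNIV. \<Sum>b\<in>UNIV. q a * q b * Re (chi (t * (a - b))))"
    by simp
  also have "\<dots> \<le> (\<Sum>a\<in>UNIV. \<Sum>b\<in>UNIV. q a * q b * \<gamma> + (if b = a then q a ^ 2 * (1 - \<gamma>) else 0))"
  proof (intro sum_mono)
    fix a b
    show "q a * q b * Re (chi (t * (a - b)))
        \<le> q a * q b * \<gamma> + (if b = a then q a ^ 2 * (1 - \<gamma>) else 0)"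
    proof (cases "b = a")
      case True
      thus ?thesis by (simp add: power2_eq_square algebra_simps)
    next
      case False
      hence "t * (a - b) \<noteq> 0"
        using assms(2) by simp
      from Re_chi_le[OF this] show ?thesis
        using False q0 by (simp add: \<gamma>_def mult_left_mono)
    qed
  qed
  also have "\<dots> = \<gamma> + S * (1 - \<gamma>)"
    by (simp add: sum.distrib S_def q1 sum_distrib_right[symmetric] sum_distrib_left[symmetric])
  also have "S \<le> (\<Sum>a\<in>UNIV. (1 - \<alpha>) * q a)"
    unfolding S_def power2_eq_square by (intro sum_mono mult_right_mono le q0)
  hence "S \<le> 1 - \<alpha>"
    by (simp add: q1 sum_distrib_left[symmetric])
  hence "\<gamma> + S * (1 - \<gamma>) \<le> \<gamma> + (1 - \<alpha>) * (1 - \<gamma>)"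
    by (intro add_left_mono mult_right_mono) (auto simp: \<gamma>_def)
  also have "\<dots> = 1 + (- (2 * char_gap CARD('p) * \<alpha>))"
    by (simp add: char_gap_def \<gamma>_def field_simps)
  also have "\<dots> \<le> exp (- (2 * char_gap CARD('p) * \<alpha>))"
    by (rule exp_ge_add_one_self)
  also have "\<dots> = (exp (- char_gap CARD('p) * \<alpha>))\<^sup>2"
    by (simp add: power2_eq_square flip: exp_add)
  finally show ?thesis
    unfolding z_def[symmetric] by (rule power2_le_imp_le) simp
qed

section \<open>Vectors of low weight and tuples avoiding them\<close>

text \<open>
  The space \<open>F\<^sub>p\<^sup>n\<close>, realised inside one function type for all \<open>n\<close>: coordinates from \<open>n\<close> on
  vanish, and addition is pointwise.
\<close>

definition fvecs :: "nat \<Rightarrow> (nat \<Rightarrow> 'p::prime_card mod_ring) set" where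
  "fvecs n = {f. \<forall>j\<ge>n. f j = 0}"

definition weight :: "nat \<Rightarrow> (nat \<Rightarrow> 'p::prime_card mod_ring) \<Rightarrow> nat" where
  "weight n f = card {j. j < n \<and> f j \<noteq> 0}"

definition low_weight :: "nat \<Rightarrow> real \<Rightarrow> (nat \<Rightarrow> 'p::prime_card mod_ring) set" where
  "low_weight n s = {f \<in> fvecs n. real (weight n f) < s}"

definition lin_closed :: "(nat \<Rightarrow> 'p::prime_card mod_ring) set \<Rightarrow> bool" where
  "lin_closed V \<longleftrightarrow> 0 \<in> V \<and> (\<forall>c. \<forall>f\<in>V. \<forall>g\<in>V. (\<lambda>j. c * f j + g j) \<in> V)"

text \<open>
  Span by recursion over the list. When the tuple is independent the recursion step is a
  bijection, so sums over a span split along the head of the list.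
\<close>

fun lspan :: "(nat \<Rightarrow> 'p::prime_card mod_ring) list \<Rightarrow> (nat \<Rightarrow> 'p mod_ring) set" where
  "lspan [] = {0}"
| "lspan (f # fs) = (\<lambda>(c, g). (\<lambda>j. c * f j + g j)) ` (UNIV \<times> lspan fs)"

text \<open>
  For \<open>L = {0}\<close> this is linear independence. If \<open>L\<close> contains \<open>0\<close> and is closed under nonzero
  scalars, it says that the tuple is independent and no nonzero vector of its span lies in \<open>L\<close>;
  it then suffices to test the combinations in which the newest coefficient is \<open>1\<close>.
\<close>

fun avoids :: "(nat \<Rightarrow> 'p::prime_card mod_ring) set \<Rightarrow> (nat \<Rightarrow> 'p mod_ring) list \<Rightarrow> bool" where
  "avoids L [] = True"
| "avoids L (f # fs) = (avoids L fs \<and> (\<forall>g\<in>lspan fs. f + g \<notin> L))"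

definition tuples ::
  "(nat \<Rightarrow> 'p::prime_card mod_ring) set \<Rightarrow> nat \<Rightarrow> (nat \<Rightarrow> 'p mod_ring) set \<Rightarrow> (nat \<Rightarrow> 'p mod_ring) list set" where
  "tuples K m L = {fs. length fs = m \<and> set fs \<subseteq> K \<and> avoids L fs}"

lemma fvecs_Suc: "fvecs (Suc n) = (\<lambda>(a, f). f(n := a)) ` (UNIV \<times> fvecs n)"
proof (intro equalityI subsetI)
  fix f :: "nat \<Rightarrow> 'p::prime_card mod_ring" assume "f \<in> fvecs (Suc n)"
  hence "f(n := 0) \<in> fvecs n" "f = (f(n := 0))(n := f n)"
    by (auto simp: fvecs_def not_less_eq_eq le_Suc_eq)
  thus "f \<in> (\<lambda>(a, f). f(n := a)) ` (UNIV \<times> fvecs n)"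
    by (metis (no_types, lifting) SigmaI UNIV_I image_eqI case_prod_conv)
qed (auto simp: fvecs_def)

text \<open>
  One identity behind both the cardinality of the space and the weight enumerator.
\<close>

lemma sum_fvecs_prod:
  fixes h :: "'p::prime_card mod_ring \<Rightarrow> 'c::comm_semiring_1"
  shows "(\<Sum>f\<in>fvecs n. \<Prod>j<n. h (f j)) = (\<Sum>a\<in>UNIV. h a) ^ n"
proof (induction n)
  case 0
  have "fvecs 0 = {0 :: nat \<Rightarrow> 'p mod_ring}"
    by (auto simp: fvecs_def)
  thus ?case by simp
next
  case (Suc n)
  have inj: "inj_on (\<lambda>(a, f). f(n := a)) (UNIV \<times> (fvecs n :: (nat \<Rightarrow> 'p mod_ring) set))"
  proof (rule inj_onI, clarify)
    fix a b and f g :: "nat \<Rightarrow> 'p mod_ring"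
    assume fg: "f \<in> fvecs n" "g \<in> fvecs n" and eq: "f(n := a) = g(n := b)"
    have "f j = g j" for j
      using fg fun_cong[OF eq, of j] by (cases "j = n") (auto simp: fvecs_def)
    with fun_cong[OF eq, of n] show "a = b \<and> f = g"
      by auto
  qed
  have "(\<Sum>f\<in>fvecs (Suc n). \<Prod>j<Suc n. h (f j))
      = (\<Sum>(a, f)\<in>UNIV \<times> fvecs n. \<Prod>j<Suc n. h ((f(n := a)) j))"
    unfolding fvecs_Suc by (subst sum.reindex[OF inj]) (simp add: case_prod_unfold)
  also have "\<dots> = (\<Sum>(a, f)\<in>UNIV \<times> fvecs n. h a * (\<Prod>j<n. h (f j)))"
    by (intro sum.cong refl) (auto simp: mult.commute)
  also have "\<dots> = (\<Sum>a\<in>UNIV. h a) ^ Suc n"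
    by (simp add: sum.cartesian_product[symmetric] sum_product[symmetric] Suc.IH)
  finally show ?case .
qed

lemma finite_fvecs [simp]: "finite (fvecs n :: (nat \<Rightarrow> 'p::prime_card mod_ring) set)"
proof (induction n)
  case 0
  have "fvecs 0 = {0 :: nat \<Rightarrow> 'p mod_ring}"
    by (auto simp: fvecs_def)
  thus ?case by simp
qed (simp add: fvecs_Suc)

lemma card_fvecs: "card (fvecs n :: (nat \<Rightarrow> 'p::prime_card mod_ring) set) = CARD('p) ^ n"
  using sum_fvecs_prod[where 'p = 'p and h = "\<lambda>_. 1 :: nat" and n = n] by simp

lemma lin_closed_fvecs: "lin_closed (fvecs n)"
  by (auto simp: lin_closed_def fvecs_def)

lemma lin_closed_plus: "lin_closed V \<Longrightarrow> f \<in> V \<Longrightarrow> g \<in> V \<Longrightarrow> f + g \<in> V"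
  unfolding lin_closed_def plus_fun_def by (metis (no_types, lifting) ext mult_1)

lemma lin_closed_scale: "lin_closed V \<Longrightarrow> f \<in> V \<Longrightarrow> (\<lambda>j. c * f j) \<in> V"
proof -
  assume "lin_closed V" "f \<in> V"
  hence "(\<lambda>j. c * f j + 0 j) \<in> V"
    unfolding lin_closed_def by blast
  thus ?thesis by simp
qed

lemma lin_closed_uminus: "lin_closed V \<Longrightarrow> f \<in> V \<Longrightarrow> - f \<in> V"
  using lin_closed_scale[of V f "-1"] by (simp add: fun_Compl_def)

lemma lin_closed_lspan: "lin_closed (lspan fs)"
proof (induction fs)
  case Nil
  show ?case by (auto simp: lin_closed_def)
next
  case (Cons f fs)
  have 0: "0 \<in> lspan fs" and cl: "\<And>c g h. g \<in> lspan fs \<Longrightarrow> h \<in> lspan fs \<Longrightarrow> (\<lambda>j. c * g j + h j) \<in> lspan fs"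
    using Cons.IH by (auto simp: lin_closed_def)
  have "0 = (\<lambda>j. 0 * f j + (0 :: nat \<Rightarrow> 'a mod_ring) j)"
    by auto
  hence "0 \<in> lspan (f # fs)"
    using 0 by force
  moreover have "(\<lambda>j. c * u j + v j) \<in> lspan (f # fs)"
    if uv: "u \<in> lspan (f # fs)" "v \<in> lspan (f # fs)" for c u v
  proof -
    from uv obtain a g b h where "g \<in> lspan fs" "h \<in> lspan fs"
      and u: "u = (\<lambda>j. a * f j + g j)" and v: "v = (\<lambda>j. b * f j + h j)"
      by auto
    have "(\<lambda>j. c * u j + v j) = (\<lambda>j. (c * a + b) * f j + (c * g j + h j))"
      by (simp add: u v algebra_simps)
    thus ?thesis
      using cl[OF \<open>g \<in> lspan fs\<close> \<open>h \<in> lspan fs\<close>, of c] by force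
  qed
  ultimately show ?case
    unfolding lin_closed_def by blast
qed

lemma zero_in_lspan: "0 \<in> lspan fs"
  using lin_closed_lspan[of fs] by (simp add: lin_closed_def)

lemma lspan_ConsE:
  assumes "v \<in> lspan (f # fs)"
  obtains c g where "g \<in> lspan fs" "v = (\<lambda>j. c * f j + g j)"
  using assms by auto

lemma lspan_ConsI: "g \<in> lspan fs \<Longrightarrow> (\<lambda>j. c * f j + g j) \<in> lspan (f # fs)"
  by force

lemma lspan_Cons_mono: "lspan fs \<subseteq> lspan (f # fs)"
  using lspan_ConsI[of _ fs 0 f] by auto

lemma set_subset_lspan: "set fs \<subseteq> lspan fs"
proof (induction fs)
  case (Cons f fs)
  have "f \<in> lspan (f # fs)"
    using lspan_ConsI[OF zero_in_lspan, of 1 f fs] by simp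
  thus ?case
    using Cons lspan_Cons_mono[of fs f] by (auto simp del: lspan.simps)
qed simp

lemma lspan_subset: "lin_closed K \<Longrightarrow> set fs \<subseteq> K \<Longrightarrow> lspan fs \<subseteq> K"
proof (induction fs)
  case (Cons f fs)
  thus ?case
    by (auto simp: lin_closed_def)
qed (auto simp: lin_closed_def)

lemma finite_lspan [simp]: "finite (lspan fs)"
  by (induction fs) auto

lemma card_lspan_le: "card (lspan (fs :: (nat \<Rightarrow> 'p::prime_card mod_ring) list)) \<le> CARD('p) ^ length fs"
proof (induction fs)
  case (Cons f fs)
  have "card (lspan (f # fs)) \<le> card (UNIV \<times> lspan fs :: ('p mod_ring \<times> _) set)"
    unfolding lspan.simps by (rule card_image_le) simp
  also have "\<dots> \<le> CARD('p) * CARD('p) ^ length fs"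
    using Cons by (simp add: card_cartesian_product)
  finally show ?case by simp
qed simp

text \<open>
  If two coefficients \<open>a \<noteq> b\<close> of \<open>f\<close> gave the same vector, then \<open>f\<close> itself would be a
  combination of \<open>fs\<close>.
\<close>

lemma inj_on_lspan_Cons:
  assumes "avoids {0} (f # fs)"
  shows "inj_on (\<lambda>(c, g). (\<lambda>j. c * f j + g j)) (UNIV \<times> lspan fs)"
proof (rule inj_onI, clarify)
  fix a b g h
  assume gh: "g \<in> lspan fs" "h \<in> lspan fs"
    and eq: "(\<lambda>j. a * f j + g j) = (\<lambda>j. b * f j + h j)"
  have e: "(a - b) * f j = h j - g j" for j
    using fun_cong[OF eq, of j] by (simp add: algebra_simps)
  have "a = b"
  proof (rule ccontr)
    assume "a \<noteq> b"
    define d where "d = inverse (a - b)"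
    have "(\<lambda>j. d * (g j - h j)) \<in> lspan fs"
      using lin_closed_scale[OF lin_closed_lspan
          lin_closed_plus[OF lin_closed_lspan gh(1) lin_closed_uminus[OF lin_closed_lspan gh(2)]], of d]
      by (simp add: fun_Compl_def)
    moreover have "f + (\<lambda>j. d * (g j - h j)) = 0"
    proof
      fix j
      have "f j = d * ((a - b) * f j)"
        using \<open>a \<noteq> b\<close> by (simp add: d_def)
      thus "(f + (\<lambda>j. d * (g j - h j))) j = 0 j"
        unfolding e by (simp add: algebra_simps)
    qed
    ultimately show False
      using assms by auto
  qed
  moreover from this have "g = h"
    using e by auto
  ultimately show "a = b \<and> g = h" ..
qed

lemma card_lspan:
  "avoids {0} fs \<Longrightarrow> card (lspan (fs :: (nat \<Rightarrow> 'p::prime_card mod_ring) list)) = CARD('p) ^ length fs"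
proof (induction fs)
  case (Cons f fs)
  have "card (lspan (f # fs)) = card (UNIV \<times> lspan fs :: ('p mod_ring \<times> _) set)"
    unfolding lspan.simps by (rule card_image[OF inj_on_lspan_Cons[OF Cons.prems]])
  thus ?case
    using Cons by (simp add: card_cartesian_product)
qed simp

lemma avoids_mono: "avoids L fs \<Longrightarrow> L' \<subseteq> L \<Longrightarrow> avoids L' fs"
  by (induction fs) auto

lemma avoids_lspan:
  assumes scale: "\<And>c f. c \<noteq> 0 \<Longrightarrow> f \<in> L \<Longrightarrow> (\<lambda>j. c * f j) \<in> L"
    and "avoids L fs" "v \<in> lspan fs" "v \<noteq> 0"
  shows "v \<notin> L"
  using assms(2-)
proof (induction fs arbitrary: v)
  case (Cons f fs)
  from Cons.prems obtain c g where g: "g \<in> lspan fs" and v: "v = (\<lambda>j. c * f j + g j)"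
    by (elim lspan_ConsE)
  show ?case
  proof (cases "c = 0")
    case True
    thus ?thesis
      using Cons g v by auto
  next
    case False
    have "f + (\<lambda>j. inverse c * g j) \<notin> L"
      using Cons.prems(1) lin_closed_scale[OF lin_closed_lspan g] by auto
    moreover have "f + (\<lambda>j. inverse c * g j) = (\<lambda>j. inverse c * v j)"
      using False by (auto simp: v algebra_simps)
    ultimately show ?thesis
      using scale[of "inverse c" v] False by auto
  qed
qed simp

lemma avoidsI:
  "avoids {0} fs \<Longrightarrow> (\<And>v. v \<in> lspan fs \<Longrightarrow> v \<noteq> 0 \<Longrightarrow> v \<notin> L) \<Longrightarrow> avoids L fs"
proof (induction fs)
  case (Cons f fs)
  have "avoids L fs"
    using Cons.IH Cons.prems lspan_Cons_mono[of fs f] by (metis avoids.simps(2) subsetD)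
  moreover have "f + g \<notin> L" if "g \<in> lspan fs" for g
  proof (rule Cons.prems(2))
    show "f + g \<in> lspan (f # fs)"
      using lspan_ConsI[OF that, of 1 f] by (simp add: plus_fun_def)
    show "f + g \<noteq> 0"
      using Cons.prems(1) that by (metis avoids.simps(2) singletonI)
  qed
  ultimately show ?case by simp
qed simp

lemma finite_tuples [simp]: "finite K \<Longrightarrow> finite (tuples K m L)"
  by (rule finite_subset[OF _ finite_lists_length_eq[of K m]]) (auto simp: tuples_def)

lemma card_tuples_le: "finite K \<Longrightarrow> card (tuples K m L) \<le> card K ^ m"
  by (rule order.trans[OF card_mono[OF _ , of "{fs. set fs \<subseteq> K \<and> length fs = m}"]])
     (auto simp: tuples_def card_lists_length_eq finite_lists_length_eq)

lemma tuples_0 [simp]: "tuples K 0 L = {[]}"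
  by (auto simp: tuples_def)

lemma tuples_Suc:
  "tuples K (Suc m) L = (\<lambda>(fs, f). f # fs) ` (SIGMA fs:tuples K m L. {f \<in> K. \<forall>g\<in>lspan fs. f + g \<notin> L})"
  (is "?lhs = ?rhs")
proof (intro equalityI subsetI)
  fix xs assume "xs \<in> ?lhs"
  then obtain f fs where "xs = f # fs" "fs \<in> tuples K m L" "f \<in> K" "\<forall>g\<in>lspan fs. f + g \<notin> L"
    by (cases xs) (auto simp: tuples_def)
  thus "xs \<in> ?rhs"
    by (intro image_eqI[of _ _ "(fs, f)"]) auto
qed (auto simp: tuples_def)

lemma card_tuples_Suc:
  "finite K \<Longrightarrow> card (tuples K (Suc m) L) = (\<Sum>fs\<in>tuples K m L. card {f \<in> K. \<forall>g\<in>lspan fs. f + g \<notin> L})"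
  unfolding tuples_Suc by (subst card_image) (auto simp: inj_on_def)

text \<open>
  An independent tuple of length \<open>i\<close> is extended by any vector of \<open>K\<close> outside its span, which
  has \<open>p ^ i\<close> elements.
\<close>

lemma card_tuples_indep:
  assumes "lin_closed (K :: (nat \<Rightarrow> 'p::prime_card mod_ring) set)" "finite K"
  shows "real (card (tuples K m {0})) = (\<Prod>i<m. real (card K) - real CARD('p) ^ i)"
proof (induction m)
  case (Suc m)
  have "real (card {f \<in> K. \<forall>g\<in>lspan fs. f + g \<notin> {0}}) = real (card K) - real CARD('p) ^ m"
    if "fs \<in> tuples K m {0}" for fs
  proof -
    have fs: "length fs = m" "set fs \<subseteq> K" "avoids {0} fs"
      using that by (auto simp: tuples_def)
    have sub: "lspan fs \<subseteq> K"
      by (rule lspan_subset) (use assms fs in auto)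
    have "(\<forall>g\<in>lspan fs. f + g \<noteq> 0) \<longleftrightarrow> f \<notin> lspan fs" for f
      using lin_closed_uminus[OF lin_closed_lspan, of _ fs]
      by (metis ab_group_add_class.ab_left_minus add.commute add.inverse_inverse eq_neg_iff_add_eq_0)
    hence "{f \<in> K. \<forall>g\<in>lspan fs. f + g \<notin> {0}} = K - lspan fs"
      by auto
    moreover have "card (lspan fs) \<le> card K"
      by (intro card_mono sub assms)
    ultimately show ?thesis
      using sub fs by (simp add: card_Diff_subset of_nat_diff card_lspan)
  qed
  hence "real (card (tuples K (Suc m) {0}))
      = (\<Sum>fs\<in>tuples K m {0}. real (card K) - real CARD('p) ^ m)"
    by (simp only: card_tuples_Suc[OF assms(2)] of_nat_sum cong: sum.cong)
  also have "\<dots> = real (card (tuples K m {0})) * (real (card K) - real CARD('p) ^ m)"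
    by (rule sum_constant)
  also have "\<dots> = (\<Prod>i<Suc m. real (card K) - real CARD('p) ^ i)"
    by (simp only: Suc.IH prod.lessThan_Suc)
  finally show ?case .
qed simp

lemma card_tuples_fvecs_le:
  fixes L :: "(nat \<Rightarrow> 'p::prime_card mod_ring) set"
  shows "real (card (tuples (fvecs n) m L)) \<le> real CARD('p) ^ (n * m)"
proof -
  have "card (tuples (fvecs n) m L) \<le> CARD('p) ^ (n * m)"
    using card_tuples_le[of "fvecs n" m L] by (simp add: card_fvecs power_mult)
  hence "real (card (tuples (fvecs n) m L)) \<le> real (CARD('p) ^ (n * m))"
    by (rule of_nat_mono)
  thus ?thesis
    by simp
qed

text \<open>
  A tuple of length \<open>i\<close> excludes at most \<open>p ^ i * card L\<close> extensions, namely the differences of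
  \<open>L\<close> and its span. If \<open>L\<close> is a negligible part of the space, almost all tuples avoid it.
\<close>

lemma card_tuples_fvecs_ge:
  fixes L :: "(nat \<Rightarrow> 'p::prime_card mod_ring) set"
  assumes L: "finite L"
  shows "real (card (tuples (fvecs n) m L))
    \<ge> real CARD('p) ^ (n * m) * (1 - real m * real CARD('p) ^ m * (real (card L) / real CARD('p) ^ n))"
proof (induction m)
  case (Suc m)
  define p where "p = real CARD('p)"
  define l where "l = real (card L) / p ^ n"
  define N where "N = real (card (tuples (fvecs n) m L))"
  have p: "p \<ge> 1" "p > 0"
    using CARD_ge_2[where 'p = 'p] by (auto simp: p_def)
  have l: "l \<ge> 0"
    using p by (simp add: l_def)
  have *: "real (card {f \<in> fvecs n. \<forall>g\<in>lspan fs. f + g \<notin> L}) \<ge> p ^ n * (1 - p ^ m * l)"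
    if "fs \<in> tuples (fvecs n) m L" for fs
  proof -
    (* An extension f is excluded only if f + g = l for some l in L and g in the span. *)
    let ?B = "(\<lambda>(g, l). l - g) ` (lspan fs \<times> L)"
    have "fvecs n - ?B \<subseteq> {f \<in> fvecs n. \<forall>g\<in>lspan fs. f + g \<notin> L}"
      by force
    hence "card (fvecs n - ?B) \<le> card {f \<in> fvecs n. \<forall>g\<in>lspan fs. f + g \<notin> L}"
      by (intro card_mono) auto
    moreover have "card (fvecs n :: (nat \<Rightarrow> 'p mod_ring) set) - card ?B \<le> card (fvecs n - ?B)"
      by (rule diff_card_le_card_Diff) (use L in auto)
    moreover have "card ?B \<le> CARD('p) ^ m * card L"
    proof -
      have "card ?B \<le> card (lspan fs \<times> L)"
        using L by (intro card_image_le) auto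
      also have "\<dots> \<le> CARD('p) ^ m * card L"
        using that card_lspan_le[of fs] by (simp add: card_cartesian_product tuples_def)
      finally show ?thesis .
    qed
    ultimately have "CARD('p) ^ n \<le> card {f \<in> fvecs n. \<forall>g\<in>lspan fs. f + g \<notin> L} + CARD('p) ^ m * card L"
      unfolding card_fvecs by linarith
    hence "real (CARD('p) ^ n) \<le> real (card {f \<in> fvecs n. \<forall>g\<in>lspan fs. f + g \<notin> L} + CARD('p) ^ m * card L)"
      by (rule of_nat_mono)
    moreover have "p ^ n * (1 - p ^ m * l) = p ^ n - p ^ m * card L"
      using p by (simp add: l_def field_simps)
    ultimately show ?thesis
      by (simp add: p_def)
  qed
  have N: "N \<le> p ^ (n * m)"
    unfolding N_def p_def by (rule card_tuples_fvecs_le)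
  have IH: "p ^ (n * m) * (1 - m * p ^ m * l) \<le> N"
    using Suc.IH by (simp add: p_def N_def l_def)
  have "p ^ (n * Suc m) * (1 - Suc m * p ^ Suc m * l) \<le> p ^ (n * Suc m) * (1 - Suc m * p ^ m * l)"
    using p l by (intro mult_left_mono diff_left_mono mult_right_mono power_increasing) auto
  also have "\<dots> = p ^ n * (p ^ (n * m) * (1 - m * p ^ m * l)) - p ^ n * p ^ m * l * p ^ (n * m)"
    by (simp add: power_add algebra_simps)
  also have "\<dots> \<le> p ^ n * N - p ^ n * p ^ m * l * N"
    using p l by (intro diff_mono mult_left_mono IH N) auto
  also have "\<dots> = (\<Sum>fs\<in>tuples (fvecs n) m L. p ^ n * (1 - p ^ m * l))"
    by (simp add: N_def algebra_simps)
  also have "\<dots> \<le> (\<Sum>fs\<in>tuples (fvecs n) m L. real (card {f \<in> fvecs n. \<forall>g\<in>lspan fs. f + g \<notin> L}))"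
    by (rule sum_mono[OF *])
  also have "\<dots> = real (card (tuples (fvecs n) (Suc m) L))"
    by (simp add: card_tuples_Suc)
  finally show ?case
    by (simp add: p_def l_def)
qed simp

lemma weight_0 [simp]: "weight n 0 = 0"
  by (simp add: weight_def)

lemma weight_scale [simp]: "c \<noteq> 0 \<Longrightarrow> weight n (\<lambda>j. c * f j) = weight n f"
  by (simp add: weight_def)

lemma weight_le_add: "weight n g \<le> weight n f + weight n (\<lambda>j. c * f j + g j)"
proof -
  have "weight n g \<le> card ({j. j < n \<and> f j \<noteq> 0} \<union> {j. j < n \<and> c * f j + g j \<noteq> 0})"
    unfolding weight_def by (intro card_mono) auto
  also have "\<dots> \<le> weight n f + weight n (\<lambda>j. c * f j + g j)"
    unfolding weight_def by (rule card_Un_le)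
  finally show ?thesis .
qed

lemma low_weight_scale: "c \<noteq> 0 \<Longrightarrow> f \<in> low_weight n s \<Longrightarrow> (\<lambda>j. c * f j) \<in> low_weight n s"
  by (auto simp: low_weight_def fvecs_def)

lemma finite_low_weight [simp]: "finite (low_weight n s)"
  by (simp add: low_weight_def)

lemma zero_in_low_weight: "s > 0 \<Longrightarrow> 0 \<in> low_weight n s"
  by (auto simp: low_weight_def fvecs_def)

lemma sum_power_weight:
  fixes t :: real
  shows "(\<Sum>f\<in>(fvecs n :: (nat \<Rightarrow> 'p::prime_card mod_ring) set). t ^ weight n f)
       = (1 + (real CARD('p) - 1) * t) ^ n"
proof -
  define h where "h = (\<lambda>a :: 'p mod_ring. if a = 0 then 1 else t)"
  have "t ^ weight n f = (\<Prod>j<n. h (f j))" for f :: "nat \<Rightarrow> 'p mod_ring"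
  proof -
    have "(\<Prod>j<n. h (f j)) = (\<Prod>j\<in>{j. j < n \<and> f j \<noteq> 0}. t)"
      by (intro prod.mono_neutral_cong_right) (auto simp: h_def)
    thus ?thesis by (simp add: weight_def)
  qed
  moreover have "(\<Sum>a\<in>UNIV. h a) = 1 + (real CARD('p) - 1) * t"
  proof -
    have "(\<Sum>a\<in>UNIV. h a) = h 0 + (\<Sum>a\<in>UNIV - {0}. h a)"
      by (rule sum.remove) auto
    also have "(\<Sum>a\<in>UNIV - {0}. h a) = (\<Sum>a\<in>UNIV - {0 :: 'p mod_ring}. t)"
      by (intro sum.cong) (auto simp: h_def)
    also have "\<dots> = (real CARD('p) - 1) * t"
      using CARD_ge_2[where 'p = 'p] by (simp add: card_Diff_singleton of_nat_diff)
    finally show ?thesis by (simp add: h_def)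
  qed
  ultimately show ?thesis
    using sum_fvecs_prod[of h n] by simp
qed

text \<open>
  Exponential Markov inequality for the weight enumerator \<open>(1 + (p - 1) t) ^ n\<close>.
\<close>

lemma card_low_weight_le:
  assumes t: "0 < t" "t < 1" and s: "s \<ge> 0"
  shows "real (card (low_weight n s :: (nat \<Rightarrow> 'p::prime_card mod_ring) set))
    \<le> exp (real n * real CARD('p) * t + s * ln (1 / t))"
proof -
  have "real (card (low_weight n s :: (nat \<Rightarrow> 'p mod_ring) set)) * t powr s
      = (\<Sum>f\<in>(low_weight n s :: (nat \<Rightarrow> 'p mod_ring) set). t powr s)"
    by simp
  also have "\<dots> \<le> (\<Sum>f\<in>(low_weight n s :: (nat \<Rightarrow> 'p mod_ring) set). t ^ weight n f)"
    using t by (intro sum_mono) (auto simp: low_weight_def powr_realpow[symmetric] intro!: powr_mono')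
  also have "\<dots> \<le> (\<Sum>f\<in>(fvecs n :: (nat \<Rightarrow> 'p mod_ring) set). t ^ weight n f)"
    using t by (intro sum_mono2) (auto simp: low_weight_def)
  also have "\<dots> = (1 + (real CARD('p) - 1) * t) ^ n"
    by (rule sum_power_weight)
  also have "\<dots> \<le> exp (real CARD('p) * t) ^ n"
  proof (rule power_mono)
    have "1 + (real CARD('p) - 1) * t \<le> 1 + real CARD('p) * t"
      using t by simp
    also have "\<dots> \<le> exp (real CARD('p) * t)"
      by (rule exp_ge_add_one_self)
    finally show "1 + (real CARD('p) - 1) * t \<le> exp (real CARD('p) * t)" .
    show "0 \<le> 1 + (real CARD('p) - 1) * t"
      using t CARD_ge_2[where 'p = 'p] by simp
  qed
  also have "\<dots> = exp (real n * real CARD('p) * t)"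
    by (simp add: exp_of_nat_mult[symmetric] mult_ac)
  finally have "real (card (low_weight n s :: (nat \<Rightarrow> 'p mod_ring) set)) \<le> exp (real n * real CARD('p) * t) / t powr s"
    using t by (simp add: field_simps)
  also have "\<dots> = exp (real n * real CARD('p) * t + s * ln (1 / t))"
    using t by (simp add: powr_def ln_div exp_add exp_diff exp_minus field_simps)
  finally show ?thesis .
qed

section \<open>The left kernel and its cardinality\<close>

definition left_kernel :: "'p::prime_card mod_ring mat \<Rightarrow> (nat \<Rightarrow> 'p mod_ring) set" where
  "left_kernel B = {f \<in> fvecs (dim_row B). \<forall>i<dim_col B. (\<Sum>j<dim_row B. f j * B $$ (j, i)) = 0}"

lemma lin_closed_left_kernel: "lin_closed (left_kernel B)"
  by (auto simp: lin_closed_def left_kernel_def fvecs_def algebra_simps sum.distrib sum_distrib_left[symmetric])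

lemma finite_left_kernel [simp]: "finite (left_kernel B)"
  by (simp add: left_kernel_def)

text \<open>
  Orthogonality: if \<open>\<psi> h \<noteq> 0\<close> for some \<open>h \<in> V\<close>, translation by \<open>h\<close> kills the sum.
\<close>

lemma lin_closed_sum_chi:
  assumes V: "lin_closed V" and "finite V" and add: "\<And>g h. \<psi> (g + h) = \<psi> g + \<psi> h"
  shows "(\<Sum>g\<in>V. chi (\<psi> g)) = (if \<forall>g\<in>V. \<psi> g = 0 then of_nat (card V) else 0)"
proof (cases "\<forall>g\<in>V. \<psi> g = 0")
  case False
  then obtain h where h: "h \<in> V" "\<psi> h \<noteq> 0" by blast
  have "(\<lambda>g. g + h) ` V = V"
    by (intro endo_inj_surj \<open>finite V\<close>) (auto intro: lin_closed_plus V h inj_onI)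
  hence "bij_betw (\<lambda>g. g + h) V V"
    by (simp add: bij_betw_def inj_on_def)
  from sum_chi_shift[OF this, of \<psi> "\<psi> h"] show ?thesis
    using h add False by auto
qed simp

text \<open>
  Coordinates with respect to the independent set \<open>S\<close>.
\<close>

lemma (in vec_space) card_span:
  fixes S :: "'a vec set"
  assumes "finite S" "S \<subseteq> carrier_vec n" "lin_indpt S" "finite (UNIV :: 'a set)"
  shows "card (span S) = CARD('a) ^ card S"
proof -
  let ?F = "S \<rightarrow>\<^sub>E (UNIV :: 'a set)"
  have SV: "S \<subseteq> carrier V"
    using assms(2) by simp
  have "span S = (\<lambda>a. lincomb a S) ` ?F"
  proof (intro equalityI subsetI)
    fix v assume "v \<in> span S"
    then obtain a where v: "v = lincomb a S"
      using finite_span[OF assms(1,2)] by auto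
    have "lincomb a S = lincomb (restrict a S) S"
      by (rule lincomb_cong) (use SV in auto)
    thus "v \<in> (\<lambda>a. lincomb a S) ` ?F"
      using v by auto
  next
    fix v assume "v \<in> (\<lambda>a. lincomb a S) ` ?F"
    thus "v \<in> span S"
      using finite_span[OF assms(1,2)] by auto
  qed
  moreover have "inj_on (\<lambda>a. lincomb a S) ?F"
  proof (rule inj_onI)
    fix a b assume ab: "a \<in> ?F" "b \<in> ?F" and eq: "lincomb a S = lincomb b S"
    have "lincomb (\<lambda>v. a v - b v) S = 0\<^sub>v n"
    proof (rule eq_vecI)
      fix i assume "i < dim_vec (0\<^sub>v n :: 'a vec)"
      hence i: "i < n" by simp
      have "lincomb (\<lambda>v. a v - b v) S $ i = (\<Sum>x\<in>S. (a x - b x) * x $ i)"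
        by (rule lincomb_index[OF i assms(2)])
      also have "\<dots> = lincomb a S $ i - lincomb b S $ i"
        by (simp add: lincomb_index[OF i assms(2)] algebra_simps sum_subtractf)
      finally show "lincomb (\<lambda>v. a v - b v) S $ i = 0\<^sub>v n $ i"
        using eq i by simp
    qed (use lincomb_dim[OF assms(1,2)] in auto)
    hence "a v - b v = 0" if "v \<in> S" for v
      using not_lindepD[OF assms(3) assms(1) order.refl, of "\<lambda>v. a v - b v"] that by auto
    thus "a = b"
      using ab by (intro PiE_ext) auto
  qed
  ultimately have "card (span S) = card ?F"
    by (simp add: card_image)
  thus ?thesis
    using assms(1) by (simp add: card_PiE)
qed

lemma card_col_space:
  fixes B :: "'p::prime_card mod_ring mat"
  assumes B: "B \<in> carrier_mat n nc"
  shows "card (vec_space.col_space n B) = CARD('p) ^ vec_space.rank n B"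
proof -
  interpret vec_space "TYPE('p mod_ring)" n .
  let ?W = "span (set (cols B))"
  have W: "set (cols B) \<subseteq> carrier V"
    using cols_dim[of B] B by simp
  obtain S where S: "maximal S (\<lambda>T. T \<subseteq> set (cols B) \<and> lin_indpt T)"
    using maximal_exists[of "(\<lambda>T. T \<subseteq> set (cols B) \<and> lin_indpt T)" "card (set (cols B))" "{}"]
    by (meson List.finite_set card_mono empty_iff empty_subsetI finite_lin_indpt2 rev_finite_subset)
  have sub: "S \<subseteq> set (cols B)" and ind: "lin_indpt S"
    using S by (auto simp: maximal_def)
  have fin: "finite S"
    using sub finite_subset by blast
  have "span S = ?W"
  proof (rule antisym)
    show "span S \<subseteq> ?W" by (rule span_is_monotone[OF sub])
    have "set (cols B) \<subseteq> span S"
    proof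
      fix s assume s: "s \<in> set (cols B)"
      show "s \<in> span S"
      proof (rule ccontr)
        assume *: "s \<notin> span S"
        have "S \<subseteq> carrier V"
          using sub W by auto
        hence "lin_indpt (S \<union> {s})" "s \<notin> S"
          using * s W lin_dep_iff_in_span[OF _ ind, of s] in_own_span[of S] by auto
        hence "\<not> maximal S (\<lambda>T. T \<subseteq> set (cols B) \<and> lin_indpt T)"
          using s sub unfolding maximal_def by (metis Un_upper1 bot_least insert_subset le_sup_iff singletonI UnI2)
        with S show False by blast
      qed
    qed
    moreover have "S \<subseteq> carrier_vec n"
      using sub cols_dim[of B] B by auto
    ultimately show "?W \<subseteq> span S"
      using span_subsetI by blast
  qed
  moreover have "card (span S) = CARD('p mod_ring) ^ card S"
    using card_span[OF fin _ ind] sub W by auto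
  ultimately show ?thesis
    using rank_card_indpt[OF B S] by (simp add: col_space_def)
qed

text \<open>
  Double counting of \<open>chi (f \<bullet> c)\<close> over \<open>c\<close> in the column space \<open>C\<close> and all vectors \<open>f\<close>. Summing
  over \<open>f\<close> first, only \<open>c = 0\<close> survives; summing over \<open>c\<close> first, only \<open>f\<close> in the left kernel
  survive. Hence \<open>card K * card C = p ^ n\<close>.
\<close>

lemma left_kernel_rank_nullity:
  fixes B :: "'p::prime_card mod_ring mat"
  assumes B: "B \<in> carrier_mat n nc"
  shows "vec_space.rank n B \<le> n" and "card (left_kernel B) = CARD('p) ^ (n - vec_space.rank n B)"
proof -
  interpret vec_space "TYPE('p mod_ring)" n .
  define C where "C = col_space B"
  define \<phi> where "\<phi> = (\<lambda>(c :: 'p mod_ring vec) f. \<Sum>j<n. f j * c $ j)"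
  have C: "C = {y \<in> carrier_vec n. \<exists>x\<in>carrier_vec nc. B *\<^sub>v x = y}"
    unfolding C_def using col_space_eq[OF B] B by simp
  have finC: "finite C"
  proof (rule finite_subset)
    show "C \<subseteq> vec n ` (fvecs n)"
    proof
      fix v assume "v \<in> C"
      hence "v \<in> carrier_vec n"
        by (simp add: C)
      hence "v = vec n (\<lambda>j. if j < n then v $ j else 0)"
        by (intro eq_vecI) auto
      thus "v \<in> vec n ` (fvecs n)"
        by (rule image_eqI[where x = "\<lambda>j. if j < n then v $ j else 0"]) (auto simp: fvecs_def)
    qed
  qed simp
  have p: "CARD('p) \<ge> 2"
    by (rule CARD_ge_2)
  have inner: "(\<Sum>f\<in>fvecs n. chi (\<phi> c f)) = (if c = 0\<^sub>v n then of_nat (CARD('p) ^ n) else 0)" if "c \<in> C" for c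
  proof -
    have "(\<Sum>f\<in>fvecs n. chi (\<phi> c f)) = (if \<forall>f\<in>fvecs n. \<phi> c f = 0 then of_nat (card (fvecs n :: (nat \<Rightarrow> 'p mod_ring) set)) else 0)"
      by (rule lin_closed_sum_chi[OF lin_closed_fvecs])
         (auto simp: \<phi>_def algebra_simps sum.distrib)
    moreover have "(\<forall>f\<in>fvecs n. \<phi> c f = 0) \<longleftrightarrow> c = 0\<^sub>v n"
    proof
      assume *: "\<forall>f\<in>fvecs n. \<phi> c f = 0"
      show "c = 0\<^sub>v n"
      proof (rule eq_vecI)
        fix j assume "j < dim_vec (0\<^sub>v n :: 'p mod_ring vec)"
        hence j: "j < n" by simp
        have "(\<lambda>i. if i = j then 1 else 0) \<in> (fvecs n :: (nat \<Rightarrow> 'p mod_ring) set)"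
          using j by (auto simp: fvecs_def)
        hence "\<phi> c (\<lambda>i. if i = j then 1 else 0) = 0"
          using * by blast
        also have "\<phi> c (\<lambda>i. if i = j then 1 else 0) = (\<Sum>i<n. if i = j then c $ i else 0)"
          unfolding \<phi>_def by (intro sum.cong) auto
        also have "\<dots> = c $ j"
          using j by simp
        finally show "c $ j = 0\<^sub>v n $ j"
          using j by simp
      qed (use that in \<open>auto simp: C\<close>)
    qed (auto simp: \<phi>_def)
    ultimately show ?thesis
      by (simp add: card_fvecs)
  qed
  have outer: "(\<Sum>c\<in>C. chi (\<phi> c f)) = (if f \<in> left_kernel B then of_nat (card C) else 0)" if f: "f \<in> fvecs n" for f
  proof -
    have phi: "\<phi> (B *\<^sub>v x) f = (\<Sum>i<nc. (\<Sum>j<n. f j * B $$ (j, i)) * x $ i)" if "x \<in> carrier_vec nc" for x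
    proof -
      have "\<phi> (B *\<^sub>v x) f = (\<Sum>j<n. \<Sum>i<nc. f j * B $$ (j, i) * x $ i)"
        using B that by (simp add: \<phi>_def scalar_prod_def sum_distrib_left mult.assoc lessThan_atLeast0)
      also have "\<dots> = (\<Sum>i<nc. (\<Sum>j<n. f j * B $$ (j, i)) * x $ i)"
        by (subst sum.swap) (simp add: sum_distrib_right)
      finally show ?thesis .
    qed
    show ?thesis
    proof (cases "f \<in> left_kernel B")
      case True
      hence "\<phi> c f = 0" if "c \<in> C" for c
        using that phi B by (auto simp: C left_kernel_def)
      thus ?thesis
        using True by simp
    next
      case False
      then obtain i where i: "i < nc" "(\<Sum>j<n. f j * B $$ (j, i)) \<noteq> 0"
        using B f by (auto simp: left_kernel_def)
      define b where "b = B *\<^sub>v unit_vec nc i"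
      have b: "b \<in> C"
        using B by (auto simp: C b_def)
      have "\<phi> b f = (\<Sum>k<nc. (\<Sum>j<n. f j * B $$ (j, k)) * unit_vec nc i $ k)"
        unfolding b_def by (rule phi) simp
      also have "\<dots> = (\<Sum>k<nc. if k = i then (\<Sum>j<n. f j * B $$ (j, k)) else 0)"
        by (rule sum.cong[OF refl]) (use i in auto)
      also have "\<dots> \<noteq> 0"
        using i by simp
      finally have nz: "\<phi> b f \<noteq> 0" .
      have add: "c + b \<in> C" if "c \<in> C" for c
      proof -
        from that b obtain x y where xy: "x \<in> carrier_vec nc" "y \<in> carrier_vec nc"
            "c = B *\<^sub>v x" "b = B *\<^sub>v y"
          by (auto simp: C)
        hence "c + b = B *\<^sub>v (x + y)"
          using B by (simp add: mult_add_distrib_mat_vec)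
        thus ?thesis
          using B xy by (auto simp: C)
      qed
      have "inj_on (\<lambda>c. c + b) C"
      proof (rule inj_onI)
        fix c d assume cd: "c \<in> C" "d \<in> C" and eq: "c + b = d + b"
        have dim: "dim_vec c = n" "dim_vec d = n" "dim_vec b = n"
          using cd b by (auto simp: C)
        show "c = d"
        proof (rule eq_vecI)
          fix j assume "j < dim_vec d"
          thus "c $ j = d $ j"
            using arg_cong[OF eq, of "\<lambda>v. v $ j"] dim by simp
        qed (simp add: dim)
      qed
      moreover from this have "(\<lambda>c. c + b) ` C = C"
        by (intro endo_inj_surj finC) (auto intro: add)
      ultimately have "bij_betw (\<lambda>c. c + b) C C"
        by (simp add: bij_betw_def)
      moreover have "\<phi> (c + b) f = \<phi> c f + \<phi> b f" if "c \<in> C" for c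
      proof -
        have "dim_vec b = n"
          using b by (auto simp: C)
        thus ?thesis
          by (simp add: \<phi>_def algebra_simps sum.distrib)
      qed
      ultimately show ?thesis
        using sum_chi_shift[of _ C "\<lambda>c. \<phi> c f" "\<phi> b f"] nz False by simp
    qed
  qed
  have z: "0\<^sub>v n \<in> C"
    using B by (auto simp: C intro!: bexI[of _ "0\<^sub>v nc"])
  have lk: "left_kernel B \<subseteq> fvecs n"
    using B by (auto simp: left_kernel_def)
  have "of_nat (CARD('p) ^ n) = (\<Sum>c\<in>C. if c = 0\<^sub>v n then of_nat (CARD('p) ^ n) else 0 :: complex)"
    using z finC by simp
  also have "\<dots> = (\<Sum>c\<in>C. \<Sum>f\<in>fvecs n. chi (\<phi> c f))"
    by (intro sum.cong refl) (simp add: inner)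
  also have "\<dots> = (\<Sum>f\<in>fvecs n. \<Sum>c\<in>C. chi (\<phi> c f))"
    by (rule sum.swap)
  also have "\<dots> = (\<Sum>f\<in>fvecs n. if f \<in> left_kernel B then of_nat (card C) else 0)"
    by (intro sum.cong refl) (simp add: outer)
  also have "\<dots> = (\<Sum>f\<in>left_kernel B. of_nat (card C))"
    using lk by (intro sum.mono_neutral_cong_right) auto
  also have "\<dots> = of_nat (card (left_kernel B) * card C)"
    by simp
  finally have eq: "card (left_kernel B) * CARD('p) ^ rank B = CARD('p) ^ n"
    unfolding of_nat_eq_iff C_def card_col_space[OF B] by simp
  have "CARD('p) ^ rank B dvd CARD('p) ^ n"
    by (metis eq dvd_triv_right)
  thus le: "rank B \<le> n"
    using p by (simp add: dvd_power_iff_le)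
  have "card (left_kernel B) * CARD('p) ^ rank B = CARD('p) ^ (n - rank B) * CARD('p) ^ rank B"
    using eq le by (simp flip: power_add)
  thus "card (left_kernel B) = CARD('p) ^ (n - rank B)"
    using p by simp
qed

section \<open>The probability that a tuple lies in the left kernel\<close>

lemma finite_carrier_mat [simp]: "finite (carrier_mat n m :: 'a::finite mat set)"
proof (rule finite_subset)
  show "carrier_mat n m \<subseteq> Matrix.mat n m ` (({..<n} \<times> {..<m}) \<rightarrow>\<^sub>E (UNIV :: 'a set))"
  proof
    fix B :: "'a mat" assume "B \<in> carrier_mat n m"
    hence "B = Matrix.mat n m (restrict (\<lambda>ij. B $$ ij) ({..<n} \<times> {..<m}))"
      by (intro eq_matI) auto
    thus "B \<in> Matrix.mat n m ` (({..<n} \<times> {..<m}) \<rightarrow>\<^sub>E UNIV)"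
      by (rule image_eqI[where x = "restrict (\<lambda>ij. B $$ ij) ({..<n} \<times> {..<m})"]) auto
  qed
qed (intro finite_imageI finite_PiE, auto)

lemma prod_one_plus_le_exp_sum: "(\<Prod>i\<in>I. 1 + f i) \<le> exp (\<Sum>i\<in>I. f i)" if "\<And>i. i \<in> I \<Longrightarrow> (f i :: real) \<ge> 0"
proof (cases "finite I")
  case True
  have "(\<Prod>i\<in>I. 1 + f i) \<le> (\<Prod>i\<in>I. exp (f i))"
    using that by (intro prod_mono) (auto intro: add_nonneg_nonneg)
  thus ?thesis
    using True by (simp add: exp_sum)
qed auto

text \<open>
  Columns are indexed from \<open>0\<close>. The parameters \<open>p\<close> and \<open>c\<close> are determined by the field and only
  abbreviate.
\<close>

locale random_matrix = prob_space M
  for M :: "'w measure" +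
  fixes n nc :: nat and A :: "'w \<Rightarrow> 'p::prime_card mod_ring mat" and \<beta> :: "nat \<Rightarrow> real"
    and p c :: real
  assumes p_eq: "p = real CARD('p)" and c_eq: "c = char_gap CARD('p)"
    and indep: "indep_entries_mat M n nc A"
    and bal: "\<And>i j. i < nc \<Longrightarrow> j < n \<Longrightarrow> balanced (\<beta> i) M (\<lambda>\<omega>. A \<omega> $$ (j, i))"
    and beta_nonneg: "\<And>i. i < nc \<Longrightarrow> \<beta> i \<ge> 0"
begin

definition entry_cf :: "nat \<Rightarrow> nat \<Rightarrow> 'p mod_ring \<Rightarrow> complex" where
  "entry_cf i j t = expectation (\<lambda>\<omega>. chi (t * A \<omega> $$ (j, i)))"

definition column_cf :: "nat \<Rightarrow> (nat \<Rightarrow> 'p mod_ring) \<Rightarrow> complex" where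
  "column_cf i g = (\<Prod>j<n. entry_cf i j (g j))"

definition kernel_prob :: "(nat \<Rightarrow> 'p mod_ring) list \<Rightarrow> real" where
  "kernel_prob fs = \<P>(\<omega> in M. set fs \<subseteq> left_kernel (A \<omega>))"

lemma p_ge_2: "p \<ge> 2"
  using CARD_ge_2[where 'p = 'p] by (simp add: p_eq)

lemma c_pos: "c > 0"
  unfolding c_eq by (rule char_gap_pos[OF CARD_ge_2])

lemma A_carrier: "\<omega> \<in> space M \<Longrightarrow> A \<omega> \<in> carrier_mat n nc"
  using indep by (simp add: indep_entries_mat_def)

lemma entry_measurable: "i < nc \<Longrightarrow> j < n \<Longrightarrow> (\<lambda>\<omega>. A \<omega> $$ (j, i)) \<in> measurable M (count_space UNIV)"
  using bal by (simp add: balanced_def)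

lemma sets_matrix_eq:
  assumes "B \<in> carrier_mat n nc"
  shows "{\<omega> \<in> space M. A \<omega> = B} \<in> sets M"
proof -
  have "{\<omega> \<in> space M. A \<omega> = B} = {\<omega> \<in> space M. \<forall>j\<in>{..<n}. \<forall>i\<in>{..<nc}. A \<omega> $$ (j, i) = B $$ (j, i)}"
    using assms A_carrier by (fastforce intro!: eq_matI)
  also have "\<dots> \<in> sets M"
    using measurable_sets[OF entry_measurable, of _ _ "{b}" for b]
    by (intro sets.sets_Collect_finite_All) (auto simp: vimage_def Int_def conj_commute)
  finally show ?thesis .
qed

lemma sets_matrix_event [measurable]: "{\<omega> \<in> space M. Q (A \<omega>)} \<in> sets M"
proof -
  have "{\<omega> \<in> space M. Q (A \<omega>)} = (\<Union>B\<in>{B \<in> carrier_mat n nc. Q B}. {\<omega> \<in> space M. A \<omega> = B})"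
    using A_carrier by auto
  also have "\<dots> \<in> sets M"
    by (intro sets.finite_UN) (auto intro: sets_matrix_eq)
  finally show ?thesis .
qed

lemma integrable_matrix_function: "integrable M (\<lambda>\<omega>. h (A \<omega>) :: real)"
proof (rule Bochner_Integration.integrable_cong[THEN iffD1, OF refl])
  show "integrable M (\<lambda>\<omega>. \<Sum>B\<in>carrier_mat n nc. h B * indicator {\<omega> \<in> space M. A \<omega> = B} \<omega>)"
    by (intro Bochner_Integration.integrable_sum integrable_mult_right integrable_real_indicator)
       (auto simp: emeasure_eq_measure)
  fix \<omega> assume "\<omega> \<in> space M"
  have "(\<Sum>B\<in>carrier_mat n nc. h B * indicator {\<omega> \<in> space M. A \<omega> = B} \<omega>)
      = (\<Sum>B\<in>carrier_mat n nc. if B = A \<omega> then h B else 0)"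
    using \<open>\<omega> \<in> space M\<close> by (intro sum.cong) (auto simp: indicator_def)
  thus "(\<Sum>B\<in>carrier_mat n nc. h B * indicator {\<omega> \<in> space M. A \<omega> = B} \<omega>) = h (A \<omega>)"
    using A_carrier[OF \<open>\<omega> \<in> space M\<close>] by simp
qed

lemma expectation_of_bool: "expectation (\<lambda>\<omega>. of_bool (Q (A \<omega>))) = \<P>(\<omega> in M. Q (A \<omega>))"
proof -
  have "expectation (\<lambda>\<omega>. of_bool (Q (A \<omega>))) = expectation (indicator {\<omega> \<in> space M. Q (A \<omega>)} :: _ \<Rightarrow> real)"
    by (intro Bochner_Integration.integral_cong refl) (auto simp: indicator_def)
  also have "\<dots> = \<P>(\<omega> in M. Q (A \<omega>))"
    using sets_matrix_event[of Q] by simp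
  finally show ?thesis .
qed

text \<open>
  Only coordinates in the support of \<open>g\<close> contribute a nontrivial factor.
\<close>

lemma norm_column_cf_le:
  assumes i: "i < nc"
  shows "norm (column_cf i g) \<le> exp (- c * \<beta> i * weight n g)"
proof -
  have "norm (column_cf i g) = (\<Prod>j<n. norm (entry_cf i j (g j)))"
    by (simp add: column_cf_def prod_norm)
  also have "\<dots> \<le> (\<Prod>j<n. if g j \<noteq> 0 then exp (- c * \<beta> i) else 1)"
  proof (intro prod_mono conjI norm_ge_zero)
    fix j assume "j \<in> {..<n}"
    thus "norm (entry_cf i j (g j)) \<le> (if g j \<noteq> 0 then exp (- c * \<beta> i) else 1)"
      using norm_expectation_chi_le[OF bal[OF i, of j], of "g j"] by (auto simp: entry_cf_def prob_space c_eq)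
  qed
  also have "\<dots> = (\<Prod>j\<in>{j. j < n \<and> g j \<noteq> 0}. exp (- c * \<beta> i))"
    by (intro prod.mono_neutral_cong_right) auto
  also have "\<dots> = exp (- c * \<beta> i * weight n g)"
    by (simp add: weight_def exp_of_nat_mult[symmetric] mult_ac)
  finally show ?thesis .
qed

lemma column_cf_0 [simp]: "column_cf i 0 = 1"
  by (simp add: column_cf_def entry_cf_def prob_space)

text \<open>
  Independence of all entries at once; different columns may be tested against different
  vectors.
\<close>

lemma expectation_prod_chi:
  "integrable M (\<lambda>\<omega>. \<Prod>i<nc. chi (\<Sum>j<n. G i j * A \<omega> $$ (j, i)))" (is ?int)
  "expectation (\<lambda>\<omega>. \<Prod>i<nc. chi (\<Sum>j<n. G i j * A \<omega> $$ (j, i))) = (\<Prod>i<nc. column_cf i (G i))" (is ?eq)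
proof -
  define X where "X = (\<lambda>(j, i) \<omega>. chi (G i j * A \<omega> $$ (j, i)))"
  let ?I = "{..<n} \<times> {..<nc}"
  have "indep_vars (\<lambda>_. count_space UNIV) (\<lambda>(j, i) \<omega>. A \<omega> $$ (j, i)) ?I"
    using indep by (simp add: indep_entries_mat_def)
  from indep_vars_compose2[OF this, of "\<lambda>(j, i) a. chi (G i j * a)" "\<lambda>_. borel"]
  have ind: "indep_vars (\<lambda>_. borel) X ?I"
    by (simp add: X_def case_prod_unfold)
  have int: "integrable M (X ij)" if "ij \<in> ?I" for ij
    using that expectation_finite_range(1)[OF entry_measurable, of "snd ij" "fst ij" "\<lambda>a. chi (G (snd ij) (fst ij) * a)"]
    by (auto simp: X_def case_prod_unfold)
  have eq: "(\<Prod>ij\<in>?I. X ij \<omega>) = (\<Prod>i<nc. chi (\<Sum>j<n. G i j * A \<omega> $$ (j, i)))" for \<omega>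
    unfolding chi_sum by (subst prod.swap) (simp add: X_def prod.cartesian_product case_prod_unfold)
  show ?int
    using indep_vars_integrable[OF _ ind int] by (simp add: eq)
  have "expectation (\<lambda>\<omega>. \<Prod>ij\<in>?I. X ij \<omega>) = (\<Prod>ij\<in>?I. expectation (X ij))"
    by (rule indep_vars_lebesgue_integral[OF _ ind int]) auto
  also have "\<dots> = (\<Prod>i<nc. column_cf i (G i))"
    unfolding column_cf_def by (subst prod.swap) (simp add: X_def prod.cartesian_product case_prod_unfold entry_cf_def)
  finally show ?eq
    by (simp add: eq)
qed

text \<open>
  The indicator of \<open>lspan fs \<subseteq> left_kernel\<close> is a product over columns of normalised character
  sums. Expanding the product gives a sum over assignments of one vector of the span to each
  column, whose expectation factorises; the result is refolded into a product over columns.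
\<close>

lemma kernel_prob_eq:
  assumes fs: "set fs \<subseteq> fvecs n" "avoids {0} fs"
  shows "complex_of_real (kernel_prob fs) = (\<Prod>i<nc. (\<Sum>g\<in>lspan fs. column_cf i g) / of_real p ^ length fs)"
proof -
  let ?V = "lspan fs"
  let ?d = "\<lambda>\<omega> i g. \<Sum>j<n. g j * A \<omega> $$ (j, i)"
  define N :: complex where "N = of_real p ^ length fs"
  have N: "N \<noteq> 0"
    using p_ge_2 by (simp add: N_def)
  have V: "?V \<subseteq> fvecs n"
    by (rule lspan_subset[OF lin_closed_fvecs fs(1)])
  have cV: "of_nat (card ?V) = N"
    using card_lspan[OF fs(2)] by (simp add: N_def p_eq)
  have col: "(\<Sum>g\<in>?V. chi (?d \<omega> i g)) / N = (if \<forall>g\<in>?V. ?d \<omega> i g = 0 then 1 else 0)" for \<omega> i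
    using N by (subst lin_closed_sum_chi[OF lin_closed_lspan])
      (auto simp: cV algebra_simps sum.distrib)
  have ev: "of_bool (set fs \<subseteq> left_kernel (A \<omega>)) = (\<Prod>i<nc. (\<Sum>g\<in>?V. chi (?d \<omega> i g)) / N)" if "\<omega> \<in> space M" for \<omega>
  proof -
    have "set fs \<subseteq> left_kernel (A \<omega>) \<longleftrightarrow> ?V \<subseteq> left_kernel (A \<omega>)"
      using lspan_subset[OF lin_closed_left_kernel] set_subset_lspan by blast
    also have "\<dots> \<longleftrightarrow> (\<forall>i<nc. \<forall>g\<in>?V. ?d \<omega> i g = 0)"
      using V A_carrier[OF that] by (auto simp: left_kernel_def)
    finally show ?thesis
      unfolding col by (auto simp: prod_zero_iff)
  qed
  have ex: "(\<Prod>i<nc. (\<Sum>g\<in>?V. chi (?d \<omega> i g)) / N)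
      = (\<Sum>G\<in>{..<nc} \<rightarrow>\<^sub>E ?V. \<Prod>i<nc. chi (?d \<omega> i (G i))) / N ^ nc" for \<omega>
    by (simp add: prod_dividef prod_sum_PiE)
  have "complex_of_real (kernel_prob fs) = of_real (expectation (\<lambda>\<omega>. of_bool (set fs \<subseteq> left_kernel (A \<omega>))))"
    using expectation_of_bool[of "\<lambda>B. set fs \<subseteq> left_kernel B"] by (simp only: kernel_prob_def)
  also have "\<dots> = expectation (\<lambda>\<omega>. of_real (of_bool (set fs \<subseteq> left_kernel (A \<omega>))))"
    by (rule integral_complex_of_real[symmetric])
  also have "\<dots> = expectation (\<lambda>\<omega>. (\<Sum>G\<in>{..<nc} \<rightarrow>\<^sub>E ?V. \<Prod>i<nc. chi (?d \<omega> i (G i))) / N ^ nc)"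
  proof (intro Bochner_Integration.integral_cong refl)
    fix \<omega> assume "\<omega> \<in> space M"
    have "complex_of_real (of_bool (set fs \<subseteq> left_kernel (A \<omega>))) = of_bool (set fs \<subseteq> left_kernel (A \<omega>))"
      by simp
    thus "complex_of_real (of_bool (set fs \<subseteq> left_kernel (A \<omega>)))
        = (\<Sum>G\<in>{..<nc} \<rightarrow>\<^sub>E ?V. \<Prod>i<nc. chi (?d \<omega> i (G i))) / N ^ nc"
      unfolding ev[OF \<open>\<omega> \<in> space M\<close>] ex .
  qed
  also have "\<dots> = (\<Sum>G\<in>{..<nc} \<rightarrow>\<^sub>E ?V. \<Prod>i<nc. column_cf i (G i)) / N ^ nc"
    by (simp add: expectation_prod_chi)
  also have "\<dots> = (\<Prod>i<nc. (\<Sum>g\<in>?V. column_cf i g) / N)"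
    by (simp add: prod_dividef prod_sum_PiE)
  finally show ?thesis
    by (simp add: N_def)
qed

text \<open>
  Multiplied by \<open>p ^ (m nc)\<close>, the probability is a product of sums whose term at \<open>0\<close> is \<open>1\<close>. The
  version with the norm is the one to be bounded factorwise.
\<close>

lemma scaled_kernel_prob_eq:
  assumes fs: "set fs \<subseteq> fvecs n" "avoids {0} fs"
  shows "p ^ (length fs * nc) * kernel_prob fs = norm (\<Prod>i<nc. \<Sum>g\<in>lspan fs. column_cf i g)"
    and "complex_of_real (p ^ (length fs * nc) * kernel_prob fs) = (\<Prod>i<nc. \<Sum>g\<in>lspan fs. column_cf i g)"
proof -
  show *: "complex_of_real (p ^ (length fs * nc) * kernel_prob fs) = (\<Prod>i<nc. \<Sum>g\<in>lspan fs. column_cf i g)"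
    using p_ge_2 unfolding of_real_mult kernel_prob_eq[OF fs]
    by (simp add: prod_dividef power_mult)
  have "kernel_prob fs \<ge> 0"
    by (simp add: kernel_prob_def)
  thus "p ^ (length fs * nc) * kernel_prob fs = norm (\<Prod>i<nc. \<Sum>g\<in>lspan fs. column_cf i g)"
    using p_ge_2 unfolding *[symmetric] norm_of_real by (simp add: abs_mult)
qed

lemma avoids_low_weight_ge:
  assumes "avoids (low_weight n s) fs" "set fs \<subseteq> fvecs n" "g \<in> lspan fs" "g \<noteq> 0"
  shows "real (weight n g) \<ge> s"
proof -
  have "g \<notin> low_weight n s"
    by (rule avoids_lspan[OF low_weight_scale assms(1,3,4)])
  moreover have "g \<in> fvecs n"
    using lspan_subset[OF lin_closed_fvecs assms(2)] assms(3) by blast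
  ultimately show ?thesis
    by (simp add: low_weight_def)
qed

lemma avoids_low_weight_indep: "avoids (low_weight n s) fs \<Longrightarrow> s > 0 \<Longrightarrow> avoids {0} fs"
  by (rule avoids_mono) (auto intro: zero_in_low_weight)

lemma norm_column_cf_le_exp:
  assumes "i < nc" "s \<le> real (weight n g)"
  shows "norm (column_cf i g) \<le> exp (- c * \<beta> i * s)"
proof -
  have "c * \<beta> i * s \<le> c * \<beta> i * weight n g"
    using assms beta_nonneg c_pos by (intro mult_left_mono mult_nonneg_nonneg) auto
  hence "exp (- c * \<beta> i * weight n g) \<le> exp (- c * \<beta> i * s)"
    by simp
  thus ?thesis
    using norm_column_cf_le[OF assms(1), of g] by linarith
qed

text \<open>
  Every factor is \<open>1\<close> plus at most \<open>p ^ m\<close> terms, each of size at most \<open>exp (- c * \<beta> i * s)\<close>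
  since the nonzero vectors of the span have weight at least \<open>s\<close>.
\<close>

lemma kernel_prob_near_uniform:
  assumes fs: "fs \<in> tuples (fvecs n) m (low_weight n s)" and s: "s > 0"
  shows "\<bar>p ^ (m * nc) * kernel_prob fs - 1\<bar> \<le> exp (p ^ m * (\<Sum>i<nc. exp (- c * \<beta> i * s))) - 1"
proof -
  have fs': "length fs = m" "set fs \<subseteq> fvecs n" "avoids (low_weight n s) fs"
    using fs by (auto simp: tuples_def)
  note ind = avoids_low_weight_indep[OF fs'(3) s]
  define e where "e = (\<lambda>i. \<Sum>g\<in>lspan fs - {0}. column_cf i g)"
  have split: "(\<Sum>g\<in>lspan fs. column_cf i g) = 1 + e i" for i
    using sum.remove[OF finite_lspan zero_in_lspan, of "column_cf i" fs] by (simp add: e_def)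
  have e_le: "norm (e i) \<le> p ^ m * exp (- c * \<beta> i * s)" if "i < nc" for i
  proof -
    have "norm (e i) \<le> (\<Sum>g\<in>lspan fs - {0}. exp (- c * \<beta> i * s))"
      unfolding e_def
      by (intro sum_norm_le norm_column_cf_le_exp that avoids_low_weight_ge[OF fs'(3,2)]) auto
    also have "\<dots> \<le> (\<Sum>g\<in>lspan fs. exp (- c * \<beta> i * s))"
      by (intro sum_mono2) auto
    also have "\<dots> = p ^ m * exp (- c * \<beta> i * s)"
      by (simp add: card_lspan[OF ind] fs' p_eq)
    finally show ?thesis .
  qed
  have "\<bar>p ^ (m * nc) * kernel_prob fs - 1\<bar> = norm (complex_of_real (p ^ (m * nc) * kernel_prob fs - 1))"
    by (simp only: norm_of_real)
  also have "complex_of_real (p ^ (m * nc) * kernel_prob fs - 1) = (\<Prod>i<nc. 1 + e i) - 1"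
    using scaled_kernel_prob_eq(2)[OF fs'(2) ind] by (simp add: fs' split)
  also have "norm \<dots> \<le> (\<Prod>i<nc. 1 + norm (e i)) - 1"
    by (rule norm_prod_minus1_le_prod_minus1)
  also have "(\<Prod>i<nc. 1 + norm (e i)) \<le> exp (\<Sum>i<nc. norm (e i))"
    by (rule prod_one_plus_le_exp_sum) auto
  also have "(\<Sum>i<nc. norm (e i)) \<le> (\<Sum>i<nc. p ^ m * exp (- c * \<beta> i * s))"
    by (intro sum_mono e_le) auto
  also have "\<dots> = p ^ m * (\<Sum>i<nc. exp (- c * \<beta> i * s))"
    by (simp add: sum_distrib_left)
  finally show ?thesis by simp
qed

text \<open>
  In the span of \<open>v # fs\<close> a vector with a nonzero part from \<open>fs\<close> has weight at least
  \<open>2 * s - s = s\<close> and is negligible, and what is left is the sum over multiples of \<open>v\<close>. So a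
  factor is at most that of the single vector \<open>v\<close>, up to a relative error whose product over the
  columns is the exponential factor.
\<close>

lemma kernel_prob_Cons_low_weight_le:
  assumes fs: "fs \<in> tuples (fvecs n) m (low_weight n (2 * s))" and s: "s > 0" and v: "v \<in> low_weight n s" "v \<noteq> 0"
  shows "p ^ (m * nc) * kernel_prob (v # fs) \<le> exp (p ^ Suc m * (\<Sum>i<nc. exp (- c * \<beta> i * s)))
      * (\<Prod>i<nc. 1 / p + (1 - 1 / p) * exp (- c * \<beta> i * weight n v))"
proof -
  have fs': "length fs = m" "set fs \<subseteq> fvecs n" "avoids (low_weight n (2 * s)) fs"
    using fs by (auto simp: tuples_def)
  have ind: "avoids {0} fs"
    using avoids_low_weight_indep[OF fs'(3)] s by simp
  have v': "v \<in> fvecs n" "real (weight n v) < s"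
    using v by (auto simp: low_weight_def)
  have heavy: "real (weight n g) \<ge> 2 * s" if "g \<in> lspan fs" "g \<noteq> 0" for g
    using avoids_low_weight_ge[OF fs'(3,2) that] .
  have ind': "avoids {0} (v # fs)"
  proof -
    (* Otherwise the span of fs would contain the low-weight vector - v. *)
    have False if "g \<in> lspan fs" "v + g = 0" for g
    proof -
      have "g = (\<lambda>j. - 1 * v j)"
        using that(2) by (auto simp: fun_eq_iff add_eq_0_iff)
      hence "weight n g = weight n v" "g \<noteq> 0"
        using v(2) by (auto simp: fun_eq_iff weight_def)
      thus False
        using heavy[OF that(1)] v' s by simp
    qed
    thus ?thesis
      using ind by auto
  qed
  define E where "E = (\<lambda>i. exp (- c * \<beta> i * s))"
  define w where "w = (\<lambda>i. exp (- c * \<beta> i * weight n v))"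
  define G where "G = (\<lambda>i. 1 / p + (1 - 1 / p) * w i)"
  have p: "p \<ge> 2" by (rule p_ge_2)
  have G: "G i \<ge> 1 / p" for i
    using p by (simp add: G_def w_def)
  have factor: "norm (\<Sum>g\<in>lspan (v # fs). column_cf i g) \<le> p * G i * (1 + p ^ Suc m * E i)" if i: "i < nc" for i
  proof -
    have "(\<Sum>g\<in>lspan (v # fs). column_cf i g)
        = (\<Sum>(a, g)\<in>UNIV \<times> lspan fs. column_cf i (\<lambda>j. a * v j + g j))"
      unfolding lspan.simps
      by (subst sum.reindex[OF inj_on_lspan_Cons[OF ind']]) (simp add: case_prod_unfold)
    also have "norm \<dots> \<le> (\<Sum>(a, g)\<in>UNIV \<times> lspan fs. norm (column_cf i (\<lambda>j. a * v j + g j)))"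
      unfolding case_prod_unfold by (rule norm_sum)
    also have "\<dots> = (\<Sum>a\<in>UNIV. \<Sum>g\<in>lspan fs. norm (column_cf i (\<lambda>j. a * v j + g j)))"
      by (rule sum.cartesian_product[symmetric])
    also have "\<dots> = (\<Sum>a\<in>UNIV. norm (column_cf i (\<lambda>j. a * v j)))
        + (\<Sum>a\<in>UNIV. \<Sum>g\<in>lspan fs - {0}. norm (column_cf i (\<lambda>j. a * v j + g j)))"
      unfolding sum.distrib[symmetric]
      by (intro sum.cong refl, subst sum.remove[OF finite_lspan zero_in_lspan]) simp
    also have "(\<Sum>a\<in>UNIV. norm (column_cf i (\<lambda>j. a * v j)))
        = norm (column_cf i (\<lambda>j. 0 * v j)) + (\<Sum>a\<in>UNIV - {0}. norm (column_cf i (\<lambda>j. a * v j)))"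
      by (rule sum.remove) auto
    also have "(\<lambda>j. 0 * v j) = 0"
      by auto
    also have "(\<Sum>a\<in>UNIV - {0}. norm (column_cf i (\<lambda>j. a * v j))) \<le> (\<Sum>a\<in>UNIV - {0 :: 'p mod_ring}. w i)"
    proof (rule sum_mono)
      fix a :: "'p mod_ring" assume "a \<in> UNIV - {0}"
      thus "norm (column_cf i (\<lambda>j. a * v j)) \<le> w i"
        using norm_column_cf_le[OF i, of "\<lambda>j. a * v j"] by (simp add: w_def)
    qed
    also have "\<dots> = (p - 1) * w i"
      using CARD_ge_2[where 'p = 'p] by (simp add: card_Diff_singleton of_nat_diff p_eq)
    also have "(\<Sum>a\<in>UNIV. \<Sum>g\<in>lspan fs - {0}. norm (column_cf i (\<lambda>j. a * v j + g j)))
        \<le> (\<Sum>a\<in>(UNIV :: 'p mod_ring set). \<Sum>g\<in>lspan fs - {0}. E i)"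
    proof (intro sum_mono)
      fix a g assume g: "g \<in> lspan fs - {0}"
      have "weight n (\<lambda>j. a * v j) \<le> weight n v"
        by (cases "a = 0") (auto simp: weight_def)
      hence "real (weight n g) \<le> real (weight n v) + real (weight n (\<lambda>j. a * v j + g j))"
        using weight_le_add[of n g v a] by linarith
      hence "s \<le> real (weight n (\<lambda>j. a * v j + g j))"
        using heavy[of g] g v' by auto
      thus "norm (column_cf i (\<lambda>j. a * v j + g j)) \<le> E i"
        unfolding E_def by (rule norm_column_cf_le_exp[OF i])
    qed
    also have "\<dots> \<le> (\<Sum>a\<in>(UNIV :: 'p mod_ring set). \<Sum>g\<in>lspan fs. E i)"
      by (intro sum_mono sum_mono2) (auto simp: E_def)
    also have "\<dots> = p ^ Suc m * E i"
      by (simp add: card_lspan[OF ind] fs' p_eq)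
    also have "norm (column_cf i 0) + (p - 1) * w i = p * G i"
      using p by (simp add: G_def field_simps)
    (* Absorb the additive error into a relative one, using p * G i >= 1. *)
    also have "p * G i + p ^ Suc m * E i \<le> p * G i + (p * G i) * (p ^ Suc m * E i)"
    proof -
      have "1 * (p ^ Suc m * E i) \<le> (p * G i) * (p ^ Suc m * E i)"
        using G[of i] p by (intro mult_right_mono) (auto simp: E_def field_simps)
      thus ?thesis by simp
    qed
    also have "\<dots> = p * G i * (1 + p ^ Suc m * E i)"
      by (simp add: algebra_simps)
    finally show ?thesis by simp
  qed
  have "p ^ (Suc m * nc) * kernel_prob (v # fs) = norm (\<Prod>i<nc. \<Sum>g\<in>lspan (v # fs). column_cf i g)"
    using scaled_kernel_prob_eq(1)[OF _ ind'] v' fs' by simp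
  also have "\<dots> = (\<Prod>i<nc. norm (\<Sum>g\<in>lspan (v # fs). column_cf i g))"
    by (rule prod_norm[symmetric])
  also have "\<dots> \<le> (\<Prod>i<nc. p * G i * (1 + p ^ Suc m * E i))"
    by (intro prod_mono conjI norm_ge_zero factor) auto
  also have "\<dots> = p ^ nc * (\<Prod>i<nc. G i) * (\<Prod>i<nc. 1 + p ^ Suc m * E i)"
    by (simp add: prod.distrib)
  also have "\<dots> \<le> p ^ nc * (\<Prod>i<nc. G i) * exp (\<Sum>i<nc. p ^ Suc m * E i)"
  proof (intro mult_left_mono prod_one_plus_le_exp_sum mult_nonneg_nonneg prod_nonneg)
    show "0 \<le> G i" for i
      using G[of i] p by (meson divide_nonneg_nonneg order.trans zero_le_one zero_le_numeral)
  qed (use p in \<open>auto simp: E_def\<close>)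
  finally have "p ^ nc * (p ^ (m * nc) * kernel_prob (v # fs)) \<le> p ^ nc * (exp (\<Sum>i<nc. p ^ Suc m * E i) * (\<Prod>i<nc. G i))"
    by (simp add: power_add mult_ac)
  hence "p ^ (m * nc) * kernel_prob (v # fs) \<le> exp (\<Sum>i<nc. p ^ Suc m * E i) * (\<Prod>i<nc. G i)"
    using p by (subst (asm) mult_le_cancel_left_pos) auto
  thus ?thesis
    by (simp add: E_def G_def w_def sum_distrib_left)
qed

end

section \<open>Moments restricted to kernels without low-weight vectors\<close>

context random_matrix
begin

definition low_weight_free :: "real \<Rightarrow> 'p mod_ring mat \<Rightarrow> bool" where
  "low_weight_free s B \<longleftrightarrow> left_kernel B \<inter> low_weight n s \<subseteq> {0}"

text \<open>
  The expected number of independent \<open>m\<close>-tuples in the left kernel, restricted to the event that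
  it contains no nonzero vector of weight below \<open>s\<close>.
\<close>

definition restricted_moment :: "real \<Rightarrow> nat \<Rightarrow> real" where
  "restricted_moment s m = expectation (\<lambda>\<omega>. of_bool (low_weight_free s (A \<omega>)) * (\<Prod>i<m. real (card (left_kernel (A \<omega>))) - p ^ i))"

text \<open>
  The product bounds the probability that \<open>v\<close> lies in the left kernel, so the sum bounds the
  expected number of nonzero vectors of weight below \<open>s\<close> in it.
\<close>

definition low_weight_mass :: "real \<Rightarrow> real" where
  "low_weight_mass s = (\<Sum>v\<in>low_weight n s - {0 :: nat \<Rightarrow> 'p mod_ring}. \<Prod>i<nc. 1 / p + (1 - 1 / p) * exp (- c * \<beta> i * weight n v))"

text \<open>
  An independent tuple in a kernel without low-weight vectors avoids low weight automatically.
\<close>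

lemma low_weight_free_falling_product:
  assumes B: "B \<in> carrier_mat n nc" and s: "s > 0" and low_weight_free: "low_weight_free s B"
  shows "(\<Prod>i<m. real (card (left_kernel B)) - p ^ i)
    = (\<Sum>fs\<in>tuples (fvecs n) m (low_weight n s). of_bool (set fs \<subseteq> left_kernel B))"
proof -
  have "(\<Prod>i<m. real (card (left_kernel B)) - p ^ i) = real (card (tuples (left_kernel B) m {0}))"
    unfolding p_eq by (rule card_tuples_indep[symmetric, OF lin_closed_left_kernel finite_left_kernel])
  also have "tuples (left_kernel B) m {0} = {fs \<in> tuples (fvecs n) m (low_weight n s). set fs \<subseteq> left_kernel B}"
  proof (intro equalityI subsetI)
    fix fs assume fs: "fs \<in> tuples (left_kernel B) m {0}"
    have sub: "lspan fs \<subseteq> left_kernel B"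
      by (rule lspan_subset[OF lin_closed_left_kernel]) (use fs in \<open>auto simp: tuples_def\<close>)
    have "avoids (low_weight n s) fs"
      by (rule avoidsI) (use fs sub low_weight_free in \<open>auto simp: tuples_def low_weight_free_def\<close>)
    thus "fs \<in> {fs \<in> tuples (fvecs n) m (low_weight n s). set fs \<subseteq> left_kernel B}"
      using fs B by (auto simp: tuples_def left_kernel_def)
  next
    fix fs assume "fs \<in> {fs \<in> tuples (fvecs n) m (low_weight n s). set fs \<subseteq> left_kernel B}"
    thus "fs \<in> tuples (left_kernel B) m {0}"
      using avoids_low_weight_indep[OF _ s] by (auto simp: tuples_def)
  qed
  also have "real (card \<dots>) = (\<Sum>fs\<in>tuples (fvecs n) m (low_weight n s). of_bool (set fs \<subseteq> left_kernel B))"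
    by (simp add: of_bool_def sum.If_cases Int_def)
  finally show ?thesis .
qed

lemma restricted_moment_le:
  assumes s: "s > 0"
  shows "restricted_moment s m \<le> (\<Sum>fs\<in>tuples (fvecs n) m (low_weight n s). kernel_prob fs)"
proof -
  have "restricted_moment s m \<le> expectation (\<lambda>\<omega>. \<Sum>fs\<in>tuples (fvecs n) m (low_weight n s). of_bool (set fs \<subseteq> left_kernel (A \<omega>)))"
    unfolding restricted_moment_def
  proof (rule integral_mono)
    fix \<omega> assume "\<omega> \<in> space M"
    show "of_bool (low_weight_free s (A \<omega>)) * (\<Prod>i<m. real (card (left_kernel (A \<omega>))) - p ^ i)
        \<le> (\<Sum>fs\<in>tuples (fvecs n) m (low_weight n s). of_bool (set fs \<subseteq> left_kernel (A \<omega>)))"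
      using low_weight_free_falling_product[OF A_carrier[OF \<open>\<omega> \<in> space M\<close>] s, of m]
      by (cases "low_weight_free s (A \<omega>)") (auto intro: sum_nonneg)
  qed (rule integrable_matrix_function)+
  also have "\<dots> = (\<Sum>fs\<in>tuples (fvecs n) m (low_weight n s). expectation (\<lambda>\<omega>. of_bool (set fs \<subseteq> left_kernel (A \<omega>))))"
    by (rule Bochner_Integration.integral_sum) (rule integrable_matrix_function)
  also have "\<dots> = (\<Sum>fs\<in>tuples (fvecs n) m (low_weight n s). kernel_prob fs)"
    unfolding kernel_prob_def by (intro sum.cong refl expectation_of_bool)
  finally show ?thesis .
qed

text \<open>
  On the event of the restriction, the moment counts at least the tuples of minimum weight
  \<open>2 * s\<close>. Off it, some nonzero \<open>v\<close> of low weight lies in the kernel together with each such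
  tuple, so the subtracted sum is at least as large as their number.
\<close>

lemma restricted_moment_ge:
  assumes s: "s > 0"
  shows "restricted_moment s m \<ge> (\<Sum>fs\<in>tuples (fvecs n) m (low_weight n (2 * s)). kernel_prob fs - (\<Sum>v\<in>low_weight n s - {0}. kernel_prob (v # fs)))"
proof -
  let ?T = "tuples (fvecs n) m (low_weight n (2 * s))"
  have sub: "?T \<subseteq> tuples (fvecs n) m (low_weight n s)"
    using s by (auto simp: tuples_def elim!: avoids_mono) (auto simp: low_weight_def)
  have "(\<Sum>fs\<in>?T. kernel_prob fs - (\<Sum>v\<in>low_weight n s - {0}. kernel_prob (v # fs)))
      = expectation (\<lambda>\<omega>. \<Sum>fs\<in>?T. of_bool (set fs \<subseteq> left_kernel (A \<omega>))
          - (\<Sum>v\<in>low_weight n s - {0}. of_bool (set (v # fs) \<subseteq> left_kernel (A \<omega>))))"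
  proof -
    have "expectation (\<lambda>\<omega>. of_bool (set fs \<subseteq> left_kernel (A \<omega>))) = kernel_prob fs" for fs
      unfolding kernel_prob_def by (rule expectation_of_bool)
    thus ?thesis
      by (subst Bochner_Integration.integral_sum Bochner_Integration.integral_diff,
          (intro integrable_matrix_function Bochner_Integration.integrable_sum Bochner_Integration.integrable_diff)+)+
         (simp del: set_simps)
  qed
  also have "\<dots> \<le> restricted_moment s m"
    unfolding restricted_moment_def
  proof (rule integral_mono)
    fix \<omega> assume \<omega>: "\<omega> \<in> space M"
    have nonneg: "0 \<le> (\<Sum>v\<in>low_weight n s - {0}. of_bool (set (v # fs) \<subseteq> left_kernel (A \<omega>)) :: real)" for fs
      by (intro sum_nonneg) auto
    show "(\<Sum>fs\<in>?T. of_bool (set fs \<subseteq> left_kernel (A \<omega>))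
          - (\<Sum>v\<in>low_weight n s - {0}. of_bool (set (v # fs) \<subseteq> left_kernel (A \<omega>))))
        \<le> of_bool (low_weight_free s (A \<omega>)) * (\<Prod>i<m. real (card (left_kernel (A \<omega>))) - p ^ i)"
    proof (cases "low_weight_free s (A \<omega>)")
      case True
      have "(\<Sum>fs\<in>?T. of_bool (set fs \<subseteq> left_kernel (A \<omega>))
          - (\<Sum>v\<in>low_weight n s - {0}. of_bool (set (v # fs) \<subseteq> left_kernel (A \<omega>))))
          \<le> (\<Sum>fs\<in>?T. of_bool (set fs \<subseteq> left_kernel (A \<omega>)) :: real)"
        using nonneg by (intro sum_mono) (simp del: list.set)
      also have "\<dots> \<le> (\<Sum>fs\<in>tuples (fvecs n) m (low_weight n s). of_bool (set fs \<subseteq> left_kernel (A \<omega>)))"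
        by (intro sum_mono2 sub) auto
      finally show ?thesis
        using low_weight_free_falling_product[OF A_carrier[OF \<omega>] s True] True by simp
    next
      case False
      then obtain v where v: "v \<in> low_weight n s - {0}" "v \<in> left_kernel (A \<omega>)"
        by (auto simp: low_weight_free_def)
      have "of_bool (set fs \<subseteq> left_kernel (A \<omega>))
          \<le> (\<Sum>v\<in>low_weight n s - {0}. of_bool (set (v # fs) \<subseteq> left_kernel (A \<omega>)) :: real)" for fs
      proof -
        have "of_bool (set fs \<subseteq> left_kernel (A \<omega>)) = (of_bool (set (v # fs) \<subseteq> left_kernel (A \<omega>)) :: real)"
          using v by simp
        also have "\<dots> \<le> (\<Sum>v\<in>low_weight n s - {0}. of_bool (set (v # fs) \<subseteq> left_kernel (A \<omega>)))"
          by (rule member_le_sum[OF v(1)]) auto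
        finally show ?thesis .
      qed
      hence "(\<Sum>fs\<in>?T. of_bool (set fs \<subseteq> left_kernel (A \<omega>))
          - (\<Sum>v\<in>low_weight n s - {0}. of_bool (set (v # fs) \<subseteq> left_kernel (A \<omega>)))) \<le> (0 :: real)"
        by (intro sum_nonpos) (simp del: list.set)
      thus ?thesis
        using False by simp
    qed
  qed (rule integrable_matrix_function)+
  finally show ?thesis .
qed

lemma restricted_moment_upper:
  assumes s: "s > 0"
  shows "restricted_moment s m \<le> p ^ (n * m) / p ^ (m * nc) * exp (p ^ m * (\<Sum>i<nc. exp (- c * \<beta> i * s)))"
proof -
  let ?T = "tuples (fvecs n) m (low_weight n s) :: (nat \<Rightarrow> 'p mod_ring) list set"
  define X where "X = exp (p ^ m * (\<Sum>i<nc. exp (- c * \<beta> i * s)))"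
  have p: "p > 0"
    using p_ge_2 by simp
  have "restricted_moment s m \<le> (\<Sum>fs\<in>?T. kernel_prob fs)"
    by (rule restricted_moment_le[OF s])
  also have "\<dots> \<le> (\<Sum>fs\<in>?T. X / p ^ (m * nc))"
  proof (rule sum_mono)
    fix fs assume "fs \<in> ?T"
    from kernel_prob_near_uniform[OF this s] have "p ^ (m * nc) * kernel_prob fs \<le> X"
      unfolding X_def by linarith
    thus "kernel_prob fs \<le> X / p ^ (m * nc)"
      using p by (simp add: field_simps)
  qed
  also have "\<dots> = real (card ?T) * (X / p ^ (m * nc))"
    by simp
  also have "\<dots> \<le> p ^ (n * m) * (X / p ^ (m * nc))"
    by (intro mult_right_mono card_tuples_fvecs_le[where 'p = 'p, folded p_eq]) (use p in \<open>auto simp: X_def\<close>)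
  finally show ?thesis
    by (simp add: X_def)
qed

lemma restricted_moment_lower:
  assumes s: "s > 0"
  defines "\<eta> \<equiv> \<Sum>i<nc. exp (- c * \<beta> i * s)"
  shows "restricted_moment s m \<ge> p ^ (n * m) / p ^ (m * nc) *
    (1 - m * p ^ m * (real (card (low_weight n (2 * s) :: (nat \<Rightarrow> 'p mod_ring) set)) / p ^ n)
       - (exp (p ^ m * \<eta>) - 1) - exp (p ^ Suc m * \<eta>) * low_weight_mass s)"
proof -
  let ?T = "tuples (fvecs n) m (low_weight n (2 * s)) :: (nat \<Rightarrow> 'p mod_ring) list set"
  define P where "P = p ^ (m * nc)"
  define X where "X = exp (p ^ m * \<eta>) - 1"
  define Y where "Y = exp (p ^ Suc m * \<eta>) * low_weight_mass s"
  define l where "l = m * p ^ m * (real (card (low_weight n (2 * s) :: (nat \<Rightarrow> 'p mod_ring) set)) / p ^ n)"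
  have p: "p \<ge> 2" "p > 0"
    using p_ge_2 by simp_all
  have eta: "\<eta> \<ge> 0"
    by (auto simp: \<eta>_def intro: sum_nonneg)
  have X: "X \<ge> 0"
    using eta p by (simp add: X_def)
  have Y: "Y \<ge> 0"
    unfolding Y_def low_weight_mass_def
    by (intro mult_nonneg_nonneg sum_nonneg prod_nonneg add_nonneg_nonneg) (use p in auto)
  have P: "P > 0"
    using p by (simp add: P_def)
  have term_ge: "kernel_prob fs - (\<Sum>v\<in>low_weight n s - {0}. kernel_prob (v # fs)) \<ge> (1 - X - Y) / P" if fs: "fs \<in> ?T" for fs
  proof -
    have "p ^ m * (\<Sum>i<nc. exp (- c * \<beta> i * (2 * s))) \<le> p ^ m * \<eta>"
      unfolding \<eta>_def
    proof (intro mult_left_mono sum_mono)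
      fix i assume "i \<in> {..<nc}"
      hence "c * \<beta> i * s \<le> c * \<beta> i * (2 * s)"
        using beta_nonneg[of i] c_pos s by (intro mult_left_mono mult_nonneg_nonneg) auto
      thus "exp (- c * \<beta> i * (2 * s)) \<le> exp (- c * \<beta> i * s)"
        by simp
    qed (use p in auto)
    hence "exp (p ^ m * (\<Sum>i<nc. exp (- c * \<beta> i * (2 * s)))) \<le> exp (p ^ m * \<eta>)"
      by (simp only: exp_le_cancel_iff)
    moreover have "\<bar>P * kernel_prob fs - 1\<bar> \<le> exp (p ^ m * (\<Sum>i<nc. exp (- c * \<beta> i * (2 * s)))) - 1"
      unfolding P_def by (rule kernel_prob_near_uniform[OF fs]) (use s in simp)
    ultimately have "\<bar>P * kernel_prob fs - 1\<bar> \<le> X"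
      unfolding X_def by linarith
    hence "P * kernel_prob fs \<ge> 1 - X"
      by linarith
    moreover have "P * (\<Sum>v\<in>low_weight n s - {0}. kernel_prob (v # fs)) \<le> Y"
    proof -
      have "P * (\<Sum>v\<in>low_weight n s - {0}. kernel_prob (v # fs)) = (\<Sum>v\<in>low_weight n s - {0}. P * kernel_prob (v # fs))"
        by (rule sum_distrib_left)
      also have "\<dots> \<le> (\<Sum>v\<in>low_weight n s - {0 :: nat \<Rightarrow> 'p mod_ring}. exp (p ^ Suc m * \<eta>)
          * (\<Prod>i<nc. 1 / p + (1 - 1 / p) * exp (- c * \<beta> i * weight n v)))"
        unfolding P_def \<eta>_def by (intro sum_mono kernel_prob_Cons_low_weight_le[OF fs s]) auto
      also have "\<dots> = Y"
        unfolding Y_def low_weight_mass_def by (rule sum_distrib_left[symmetric])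
      finally show ?thesis .
    qed
    ultimately have "1 - X - Y \<le> P * (kernel_prob fs - (\<Sum>v\<in>low_weight n s - {0}. kernel_prob (v # fs)))"
      unfolding right_diff_distrib by linarith
    thus ?thesis
      using P by (simp add: field_simps)
  qed
  have card_ge: "real (card ?T) \<ge> p ^ (n * m) * (1 - l)"
    using card_tuples_fvecs_ge[of "low_weight n (2 * s) :: (nat \<Rightarrow> 'p mod_ring) set" n m]
    by (simp add: l_def p_eq)
  have "p ^ (n * m) / P * (1 - l - X - Y) = (p ^ (n * m) * (1 - l) - p ^ (n * m) * (X + Y)) / P"
    by (simp add: algebra_simps diff_divide_distrib add_divide_distrib)
  also have "\<dots> \<le> (real (card ?T) - real (card ?T) * (X + Y)) / P"
    using P X Y by (intro divide_right_mono diff_mono card_ge mult_right_mono card_tuples_fvecs_le[where 'p = 'p, folded p_eq]) auto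
  also have "\<dots> = (\<Sum>fs\<in>?T. (1 - X - Y) / P)"
    by (simp add: algebra_simps diff_divide_distrib add_divide_distrib)
  also have "\<dots> \<le> (\<Sum>fs\<in>?T. kernel_prob fs - (\<Sum>v\<in>low_weight n s - {0}. kernel_prob (v # fs)))"
    by (rule sum_mono[OF term_ge])
  also have "\<dots> \<le> restricted_moment s m"
    by (rule restricted_moment_ge[OF s])
  finally show ?thesis
    by (simp only: P_def X_def Y_def l_def)
qed

text \<open>
  The case of the empty tuple, by the union bound.
\<close>

lemma prob_low_weight_in_kernel_le:
  assumes s: "s > 0"
  shows "\<P>(\<omega> in M. \<not> low_weight_free s (A \<omega>)) \<le> exp (p * (\<Sum>i<nc. exp (- c * \<beta> i * s))) * low_weight_mass s"
proof -
  have "\<P>(\<omega> in M. \<not> low_weight_free s (A \<omega>)) \<le> prob (\<Union>v\<in>low_weight n s - {0}. {\<omega> \<in> space M. set [v] \<subseteq> left_kernel (A \<omega>)})"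
    by (intro finite_measure_mono sets.finite_UN sets_matrix_event) (auto simp: low_weight_free_def)
  also have "\<dots> \<le> (\<Sum>v\<in>low_weight n s - {0}. kernel_prob [v])"
    unfolding kernel_prob_def by (intro finite_measure_subadditive_finite) (auto simp del: list.set)
  also have "\<dots> \<le> exp (p * (\<Sum>i<nc. exp (- c * \<beta> i * s))) * low_weight_mass s"
    unfolding low_weight_mass_def sum_distrib_left
  proof (rule sum_mono)
    fix v assume "v \<in> low_weight n s - {0 :: nat \<Rightarrow> 'p mod_ring}"
    thus "kernel_prob [v] \<le> exp (\<Sum>i<nc. p * exp (- c * \<beta> i * s)) * (\<Prod>i<nc. 1 / p + (1 - 1 / p) * exp (- c * \<beta> i * weight n v))"
      using kernel_prob_Cons_low_weight_le[of "[]" 0 s v] s by (simp add: sum_distrib_left)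
  qed
  finally show ?thesis .
qed

end

section \<open>Low-weight vectors rarely lie in the kernel\<close>

lemma half_min_le_one_minus_exp:
  assumes "(y :: real) \<ge> 0"
  shows "min y 1 / 2 \<le> 1 - exp (- y)"
proof -
  have "exp (- y) = 1 / exp y"
    by (simp add: exp_minus field_simps)
  also have "\<dots> \<le> 1 / (1 + y)"
    using assms exp_ge_add_one_self[of y] by (intro divide_left_mono) auto
  finally have e: "exp (- y) \<le> 1 / (1 + y)" .
  show ?thesis
  proof (cases "y \<le> 1")
    case True
    have "y * y \<le> y * 1"
      using True assms by (intro mult_left_mono) auto
    hence "1 / (1 + y) \<le> 1 - y / 2"
      using assms by (simp add: field_simps)
    thus ?thesis
      using e True by simp
  next
    case False
    hence "1 / (1 + y) \<le> 1 / 2"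
      by (intro divide_left_mono) auto
    moreover have "min y 1 = 1"
      using False by simp
    ultimately show ?thesis
      using e by linarith
  qed
qed

text \<open>
  Here the left-hand side is the bound for the probability that a vector is orthogonal to a
  column; it is \<open>1\<close> minus \<open>(1 - 1 / p) (1 - exp (- x))\<close> with \<open>1 - 1 / p \<ge> 1 / 2\<close>.
\<close>

lemma mixture_le_exp:
  assumes p: "p \<ge> (2 :: real)" and "x \<ge> 0"
  shows "1 / p + (1 - 1 / p) * exp (- x) \<le> exp (- (1 - exp (- x)) / 2)"
proof -
  have "1 / p + (1 - 1 / p) * exp (- x) = 1 + (- (1 - 1 / p) * (1 - exp (- x)))"
    by (simp add: algebra_simps)
  also have "\<dots> \<le> 1 + (- (1 - exp (- x)) / 2)"
  proof -
    have "(1 / 2) * (1 - exp (- x)) \<le> (1 - 1 / p) * (1 - exp (- x))"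
      using assms by (intro mult_right_mono) (auto simp: field_simps)
    thus ?thesis
      unfolding mult_minus_left by linarith
  qed
  also have "\<dots> \<le> exp (- (1 - exp (- x)) / 2)"
    by (rule exp_ge_add_one_self)
  finally show ?thesis .
qed

context random_matrix
begin

text \<open>
  A heavy column contributes at most \<open>exp (- min y 1 / 4)\<close> with \<open>y = 16 w ln n / n\<close>, and there
  are at least \<open>n / 2\<close> of them. For \<open>y \<le> 1\<close> this gives \<open>exp (- 2 w ln n)\<close>, otherwise
  \<open>exp (- n / 8)\<close>.
\<close>

lemma prod_mixture_le:
  assumes n: "n \<ge> 1"
    and good: "2 * card {i. i < nc \<and> \<beta> i \<ge> 16 / c * ln n / n} \<ge> n"
  shows "(\<Prod>i<nc. 1 / p + (1 - 1 / p) * exp (- c * \<beta> i * real w)) \<le> (1 / real n ^ 2) ^ w + exp (- real n / 8)"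
proof -
  let ?G = "{i. i < nc \<and> \<beta> i \<ge> 16 / c * ln n / n}"
  define F where "F = (\<lambda>i. 1 / p + (1 - 1 / p) * exp (- (c * \<beta> i * real w)))"
  define y where "y = 16 * ln (real n) / n * w"
  have p: "p \<ge> 2" by (rule p_ge_2)
  have ln: "ln (real n) \<ge> 0"
    using n by simp
  have y: "y \<ge> 0"
    using ln by (simp add: y_def)
  have F0: "F i \<ge> 0" for i
    using p by (auto simp: F_def intro!: add_nonneg_nonneg mult_nonneg_nonneg)
  have x: "c * \<beta> i * real w \<ge> 0" if "i < nc" for i
    using c_pos beta_nonneg[OF that] by simp
  have F1: "F i \<le> 1" if "i < nc" for i
  proof -
    have "F i \<le> exp (- (1 - exp (- (c * \<beta> i * real w))) / 2)"
      unfolding F_def by (rule mixture_le_exp[OF p x[OF that]])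
    also have "\<dots> \<le> 1"
      using x[OF that] by simp
    finally show ?thesis .
  qed
  have Fg: "F i \<le> exp (- min y 1 / 4)" if "i \<in> ?G" for i
  proof -
    have i: "i < nc" and "16 / c * ln n / n \<le> \<beta> i"
      using that by auto
    hence "c * (16 / c * ln n / n) * w \<le> c * \<beta> i * w"
      using c_pos by (intro mult_right_mono mult_left_mono) auto
    hence "y \<le> c * \<beta> i * w"
      using c_pos by (simp add: y_def)
    hence "exp (- (c * \<beta> i * w)) \<le> exp (- y)"
      by simp
    hence "min y 1 / 2 \<le> 1 - exp (- (c * \<beta> i * w))"
      using half_min_le_one_minus_exp[OF y] by linarith
    hence "exp (- (1 - exp (- (c * \<beta> i * real w))) / 2) \<le> exp (- min y 1 / 4)"
      by simp
    thus ?thesis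
      using mixture_le_exp[OF p x[OF i]] unfolding F_def by linarith
  qed
  have "(\<Prod>i<nc. F i) = (\<Prod>i\<in>{..<nc} - ?G. F i) * (\<Prod>i\<in>?G. F i)"
    by (rule prod.subset_diff) auto
  also have "\<dots> \<le> 1 * (\<Prod>i\<in>?G. F i)"
    using F0 F1 by (intro mult_right_mono prod_le_1 prod_nonneg) auto
  also have "(\<Prod>i\<in>?G. F i) \<le> (\<Prod>i\<in>?G. exp (- min y 1 / 4))"
    using F0 Fg by (intro prod_mono) auto
  also have "\<dots> = exp (card ?G * (- min y 1 / 4))"
    unfolding exp_of_nat_mult by simp
  also have "\<dots> \<le> exp (n / 2 * (- min y 1 / 4))"
  proof -
    have "real n \<le> real (2 * card ?G)"
      using good by (rule of_nat_mono)
    hence "real n / 2 * (min y 1 / 4) \<le> card ?G * (min y 1 / 4)"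
      using y by (intro mult_right_mono) auto
    thus ?thesis by simp
  qed
  also have "\<dots> \<le> (1 / real n ^ 2) ^ w + exp (- real n / 8)"
  proof (cases "y \<le> 1")
    case True
    have "n / 2 * (- min y 1 / 4) = real w * (- (2 * ln n))"
      using True n by (simp add: y_def)
    hence "exp (n / 2 * (- min y 1 / 4)) = exp (- (2 * ln n)) ^ w"
      by (simp only: exp_of_nat_mult)
    also have "exp (- (2 * ln n)) = 1 / real n ^ 2"
      using n by (simp add: exp_minus exp_double inverse_eq_divide)
    finally show ?thesis by simp
  qed simp
  finally show ?thesis
    by (simp add: F_def)
qed

text \<open>
  The first term of \<open>prod_mixture_le\<close> is summed over all nonzero vectors by the weight
  enumerator at \<open>1 / n\<^sup>2\<close>, which gives \<open>(1 + (p - 1) / n\<^sup>2) ^ n - 1\<close>; the second is multiplied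
  by the number of low-weight vectors.
\<close>

lemma low_weight_mass_le:
  assumes n: "n \<ge> 1"
    and good: "2 * card {i. i < nc \<and> \<beta> i \<ge> 16 / c * ln n / n} \<ge> n"
  shows "low_weight_mass s \<le> (exp (p / n) - 1) + card (low_weight n s :: (nat \<Rightarrow> 'p mod_ring) set) * exp (- real n / 8)"
proof -
  let ?L = "low_weight n s :: (nat \<Rightarrow> 'p mod_ring) set"
  define t where "t = 1 / real n ^ 2"
  have t: "t > 0"
    using n by (simp add: t_def)
  have "low_weight_mass s \<le> (\<Sum>v\<in>?L - {0}. t ^ weight n v + exp (- real n / 8))"
    unfolding low_weight_mass_def t_def by (intro sum_mono prod_mixture_le n good)
  also have "\<dots> = (\<Sum>v\<in>?L - {0}. t ^ weight n v) + card (?L - {0}) * exp (- real n / 8)"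
    by (simp add: sum.distrib)
  also have "(\<Sum>v\<in>?L - {0}. t ^ weight n v) \<le> (\<Sum>v\<in>fvecs n - {0 :: nat \<Rightarrow> 'p mod_ring}. t ^ weight n v)"
    using t by (intro sum_mono2) (auto simp: low_weight_def)
  also have "\<dots> = (\<Sum>v\<in>(fvecs n :: (nat \<Rightarrow> 'p mod_ring) set). t ^ weight n v) - 1"
  proof -
    have "0 \<in> (fvecs n :: (nat \<Rightarrow> 'p mod_ring) set)"
      by (simp add: fvecs_def)
    thus ?thesis
      by (simp add: sum_diff1)
  qed
  also have "\<dots> = (1 + (p - 1) * t) ^ n - 1"
    by (simp add: sum_power_weight p_eq)
  also have "(1 + (p - 1) * t) ^ n \<le> exp (p * t) ^ n"
  proof (rule power_mono)
    have "1 + (p - 1) * t \<le> 1 + p * t"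
      using t by simp
    also have "\<dots> \<le> exp (p * t)"
      by (rule exp_ge_add_one_self)
    finally show "1 + (p - 1) * t \<le> exp (p * t)" .
  qed (use t p_ge_2 in simp)
  also have "exp (p * t) ^ n = exp (p / n)"
    using n by (simp add: exp_of_nat_mult[symmetric] t_def power2_eq_square)
  also have "real (card (?L - {0})) * exp (- real n / 8) \<le> card ?L * exp (- real n / 8)"
    by (intro mult_right_mono of_nat_mono card_mono) auto
  finally show ?thesis by simp
qed

end

text \<open>
  The threshold \<open>\<delta>\<close> for weights. It makes the number of vectors of weight below \<open>\<delta> n\<close> at most
  \<open>exp (n / 16)\<close> and below \<open>2 \<delta> n\<close> at most \<open>exp (3 n / 32)\<close>; the first has to be small against
  \<open>exp (n / 8)\<close>, the second against \<open>p ^ n\<close>.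
\<close>

definition low_density :: "real \<Rightarrow> real" where
  "low_density p = 1 / (32 * ln (32 * p))"

lemma low_density_pos: "p \<ge> 2 \<Longrightarrow> low_density p > 0"
  by (simp add: low_density_def)

lemma card_low_weight_density_le:
  assumes "a \<ge> 0"
  shows "real (card (low_weight n (a * (low_density (real CARD('p)) * real n)) :: (nat \<Rightarrow> 'p::prime_card mod_ring) set))
    \<le> exp ((1 + a) * real n / 32)"
proof -
  define p where "p = real CARD('p)"
  have p: "p \<ge> 2"
    using CARD_ge_2[where 'p = 'p] by (simp add: p_def)
  have "real (card (low_weight n (a * (low_density p * real n)) :: (nat \<Rightarrow> 'p mod_ring) set))
      \<le> exp (real n * real CARD('p) * (1 / (32 * p)) + a * (low_density p * real n) * ln (1 / (1 / (32 * p))))"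
    using p assms low_density_pos[OF p] by (intro card_low_weight_le) auto
  also have "real n * real CARD('p) * (1 / (32 * p)) + a * (low_density p * real n) * ln (1 / (1 / (32 * p)))
      = (1 + a) * real n / 32"
  proof -
    have "ln (32 * p) > 0"
      using p by simp
    thus ?thesis
      using p by (simp add: low_density_def p_def[symmetric] field_simps)
  qed
  finally show ?thesis
    by (simp add: p_def)
qed

text \<open>
  A column below the threshold contributes more than \<open>1 / n\<close> to the sum, so fewer than \<open>n / 2\<close>
  columns are below it.
\<close>

lemma many_heavy_columns:
  fixes b :: "nat \<Rightarrow> real" and n nc :: nat
  assumes n: "n \<ge> 1" "nc \<ge> n" and c: "c > 0"
    and small: "(\<Sum>i<nc. exp (- (c / 16) * b i * n)) < 1 / 2"
  shows "2 * card {i. i < nc \<and> b i \<ge> 16 / c * ln n / n} \<ge> n"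
proof -
  let ?B = "{i. i < nc \<and> b i < 16 / c * ln n / n}"
  have "card ?B * (1 / n) = (\<Sum>i\<in>?B. 1 / real n)"
    by simp
  also have "\<dots> \<le> (\<Sum>i\<in>?B. exp (- (c / 16) * b i * n))"
  proof (rule sum_mono)
    fix i assume "i \<in> ?B"
    hence "(c / 16) * b i * n \<le> (c / 16) * (16 / c * ln n / n) * n"
      using c by (intro mult_right_mono mult_left_mono) auto
    also have "\<dots> = ln n"
      using c n by simp
    finally have "- ln n \<le> - (c / 16) * b i * n"
      by simp
    hence "exp (- ln n) \<le> exp (- (c / 16) * b i * n)"
      by simp
    thus "1 / real n \<le> exp (- (c / 16) * b i * n)"
      using n by (simp add: exp_minus inverse_eq_divide)
  qed
  also have "\<dots> \<le> (\<Sum>i<nc. exp (- (c / 16) * b i * n))"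
    by (intro sum_mono2) auto
  also note small
  finally have "card ?B * (1 / real n) < 1 / 2" .
  hence "2 * card ?B < n"
    using n by (simp add: field_simps)
  moreover have "card {i. i < nc \<and> b i \<ge> 16 / c * ln n / n} + card ?B = card {..<nc}"
  proof -
    have "card ({i. i < nc \<and> b i \<ge> 16 / c * ln n / n} \<union> ?B)
        = card {i. i < nc \<and> b i \<ge> 16 / c * ln n / n} + card ?B"
      by (rule card_Un_disjoint) auto
    moreover have "{i. i < nc \<and> b i \<ge> 16 / c * ln n / n} \<union> ?B = {..<nc}"
      by auto
    ultimately show ?thesis
      by (simp only:)
  qed
  ultimately show ?thesis
    using n unfolding card_lessThan by linarith
qed

section \<open>Inversion of the moments and the limiting series\<close>

text \<open>
  The \<open>q\<close>-factorial at \<open>q = p\<close>, scaled by \<open>(p - 1) ^ j\<close>.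
\<close>

definition qfac :: "real \<Rightarrow> nat \<Rightarrow> real" where
  "qfac p j = (\<Prod>l=1..j. p ^ l - 1)"

text \<open>
  The number of ordered bases of \<open>F\<^sub>p\<^sup>k\<close>.
\<close>

definition gl_order :: "real \<Rightarrow> nat \<Rightarrow> real" where
  "gl_order p k = (\<Prod>i<k. p ^ k - p ^ i)"

text \<open>
  This is \<open>(- 1) ^ j p ^ (j (j - 1) / 2)\<close> times the Gaussian binomial coefficient \<open>k + j\<close> over
  \<open>k\<close>, divided by \<open>gl_order p (k + j)\<close>: the weight of the \<open>(k + j)\<close>-th moment in the Gaussian
  inversion formula. The product form keeps all exponents integral and free of divisions by two.
\<close>

definition inv_coeff :: "real \<Rightarrow> nat \<Rightarrow> nat \<Rightarrow> real" where
  "inv_coeff p k j = (- 1) ^ j / (gl_order p k * p ^ (k * j) * qfac p j)"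

lemma qfac_0 [simp]: "qfac p 0 = 1"
  by (simp add: qfac_def)

lemma qfac_Suc [simp]: "qfac p (Suc j) = qfac p j * (p ^ Suc j - 1)"
  by (simp add: qfac_def)

lemma qfac_pos: "p > 1 \<Longrightarrow> qfac p j > 0"
  unfolding qfac_def by (intro prod_pos) (auto intro: one_less_power)

lemma gl_order_pos: "p > 1 \<Longrightarrow> gl_order p k > 0"
  unfolding gl_order_def by (intro prod_pos) (auto intro: power_strict_increasing)

text \<open>
  Truncated alternating sums of Gaussian binomial coefficients have a closed form whose sign is
  visible; the induction step comes down to \<open>(p ^ Suc J - 1) - (y - 1) = p ^ Suc J - y\<close>.
\<close>

lemma alternating_sum_falling:
  assumes p: "p > 1"
  shows "(\<Sum>j\<le>J. (- 1) ^ j * (\<Prod>i<j. y - p ^ i) / qfac p j) = (- 1) ^ J * (\<Prod>i=1..J. y - p ^ i) / qfac p J"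
proof (induction J)
  case (Suc J)
  have shift: "(\<Prod>i<Suc J. y - p ^ i) = (y - 1) * (\<Prod>i=1..J. y - p ^ i)"
    by (subst prod.lessThan_Suc_shift) (simp add: prod.atLeast1_atMost_eq)
  have q: "qfac p J \<noteq> 0" "p ^ Suc J - 1 \<noteq> 0"
    using qfac_pos[OF p, of J] one_less_power[OF p, of "Suc J"] by auto
  have "(\<Sum>j\<le>Suc J. (- 1) ^ j * (\<Prod>i<j. y - p ^ i) / qfac p j)
      = (- 1) ^ J * (\<Prod>i=1..J. y - p ^ i) / qfac p J
        + (- 1) ^ Suc J * ((y - 1) * (\<Prod>i=1..J. y - p ^ i)) / (qfac p J * (p ^ Suc J - 1))"
    by (simp only: sum.atMost_Suc Suc.IH shift qfac_Suc)
  also have "\<dots> = (- 1) ^ J * (\<Prod>i=1..J. y - p ^ i) * ((p ^ Suc J - 1) - (y - 1)) / (qfac p J * (p ^ Suc J - 1))"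
    using q by (simp add: divide_simps del: power_Suc) (simp add: algebra_simps)
  also have "\<dots> = (- 1) ^ Suc J * (\<Prod>i=1..Suc J. y - p ^ i) / qfac p (Suc J)"
    by (simp add: algebra_simps)
  finally show ?case .
qed simp

lemma falling_split:
  assumes "p \<noteq> (0 :: real)"
  shows "(\<Prod>i<k + j. x - p ^ i) = (\<Prod>i<k. x - p ^ i) * (p ^ (k * j) * (\<Prod>i<j. x / p ^ k - p ^ i))"
proof (induction j)
  case (Suc j)
  have "x - p ^ (k + j) = p ^ k * (x / p ^ k - p ^ j)"
    using assms by (simp add: field_simps power_add)
  thus ?case
    by (simp add: Suc.IH power_add mult_ac)
qed simp

lemma inversion_partial_sum:
  assumes p: "p > 1"
  shows "(\<Sum>j\<le>J. inv_coeff p k j * (\<Prod>i<k + j. x - p ^ i))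
    = (\<Prod>i<k. x - p ^ i) / gl_order p k * ((- 1) ^ J * (\<Prod>i=1..J. x / p ^ k - p ^ i) / qfac p J)"
proof -
  have cancel: "e / (g * q * r) * (a * (q * b)) = a / g * (e * b / r)" if "q \<noteq> 0" for a b e g q r :: real
    using that by simp
  have p0: "p \<noteq> 0"
    using p by simp
  have "inv_coeff p k j * (\<Prod>i<k + j. x - p ^ i)
      = (\<Prod>i<k. x - p ^ i) / gl_order p k * ((- 1) ^ j * (\<Prod>i<j. x / p ^ k - p ^ i) / qfac p j)" for j
    unfolding inv_coeff_def falling_split[OF p0, where k = k and j = j]
    by (rule cancel) (use p0 in simp)
  thus ?thesis
    by (simp only: sum_distrib_left[symmetric] alternating_sum_falling[OF p])
qed

text \<open>
  Bonferroni inequalities for the indicator of dimension \<open>k\<close>. For \<open>d < k\<close> all terms vanish, for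
  \<open>d = k\<close> the closed form is \<open>1\<close>, and for \<open>d > k\<close> it has the sign of \<open>(- 1) ^ J\<close>, as the product
  \<open>\<Prod>i=1..J. p ^ (d - k) - p ^ i\<close> contains a zero before it could change sign.
\<close>

lemma inversion_bounds:
  assumes p: "p > 1"
  shows "even J \<Longrightarrow> of_bool (d = k) \<le> (\<Sum>j\<le>J. inv_coeff p k j * (\<Prod>i<k + j. p ^ d - p ^ i))"
    and "odd J \<Longrightarrow> (\<Sum>j\<le>J. inv_coeff p k j * (\<Prod>i<k + j. p ^ d - p ^ i)) \<le> of_bool (d = k)"
proof -
  define S where "S = (\<Sum>j\<le>J. inv_coeff p k j * (\<Prod>i<k + j. p ^ d - p ^ i))"
  note S = inversion_partial_sum[OF p, where J = J and k = k and x = "p ^ d", folded S_def]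
  consider "d < k" | "d = k" | "d > k" by linarith
  hence "(even J \<longrightarrow> of_bool (d = k) \<le> S) \<and> (odd J \<longrightarrow> S \<le> of_bool (d = k))"
  proof cases
    case 1
    hence "(\<Prod>i<k. p ^ d - p ^ i) = 0"
      by (auto intro: prod_zero)
    hence "S = 0"
      unfolding S by simp
    thus ?thesis
      using 1 by simp
  next
    case 2
    have "(\<Prod>i=1..J. 1 - p ^ i) = (\<Prod>i=1..J. (- 1) * (p ^ i - 1))"
      by simp
    also have "\<dots> = (- 1) ^ J * qfac p J"
      unfolding prod.distrib by (simp add: qfac_def)
    finally have "(- 1) ^ J * (\<Prod>i=1..J. 1 - p ^ i) = ((- 1) ^ J * (- 1) ^ J) * qfac p J"
      by (simp only: mult.assoc)
    also have "(- 1 :: real) ^ J * (- 1) ^ J = 1"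
      by (simp flip: power_mult_distrib)
    finally have "S = 1"
      using S 2 p gl_order_pos[OF p, of k] qfac_pos[OF p, of J] by (simp add: gl_order_def)
    thus ?thesis
      using 2 by simp
  next
    case 3
    have dk: "p ^ d / p ^ k = p ^ (d - k)"
      using 3 p by (simp add: power_diff)
    have F: "(\<Prod>i<k. p ^ d - p ^ i) / gl_order p k \<ge> 0"
      using 3 p gl_order_pos[OF p, of k]
      by (intro divide_nonneg_pos prod_nonneg) (auto intro!: power_increasing)
    have "(\<Prod>i=1..J. p ^ (d - k) - p ^ i) \<ge> 0"
    proof (cases "d - k \<le> J")
      case True
      hence "(\<Prod>i=1..J. p ^ (d - k) - p ^ i) = 0"
        using 3 by (intro prod_zero) auto
      thus ?thesis by linarith
    next
      case False
      thus ?thesis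
        using p by (intro prod_nonneg) (auto intro!: power_increasing)
    qed
    hence "(\<Prod>i<k. p ^ d - p ^ i) / gl_order p k * ((\<Prod>i=1..J. p ^ (d - k) - p ^ i) / qfac p J) \<ge> 0"
      using qfac_pos[OF p, of J] by (intro mult_nonneg_nonneg[OF F] divide_nonneg_pos[of "\<Prod>i=1..J. p ^ (d - k) - p ^ i"]) auto
    moreover have "S = (- 1) ^ J * ((\<Prod>i<k. p ^ d - p ^ i) / gl_order p k * ((\<Prod>i=1..J. p ^ (d - k) - p ^ i) / qfac p J))"
      using S dk by simp
    ultimately show ?thesis
      using 3 by (auto simp del: prod_zero_iff)
  qed
  thus "even J \<Longrightarrow> of_bool (d = k) \<le> (\<Sum>j\<le>J. inv_coeff p k j * (\<Prod>i<k + j. p ^ d - p ^ i))"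
    and "odd J \<Longrightarrow> (\<Sum>j\<le>J. inv_coeff p k j * (\<Prod>i<k + j. p ^ d - p ^ i)) \<le> of_bool (d = k)"
    by (auto simp: S_def)
qed

text \<open>
  Euler's series for \<open>\<Prod>l. 1 - z / p ^ Suc l\<close>.
\<close>

definition euler_sum :: "real \<Rightarrow> real \<Rightarrow> real" where
  "euler_sum p z = (\<Sum>j. (- z) ^ j / qfac p j)"

lemma summable_inverse_qfac:
  assumes p: "p \<ge> 2"
  shows "summable (\<lambda>j. 1 / qfac p j)"
proof (rule summable_ratio_test)
  fix j :: nat assume j: "j \<ge> 1"
  have q: "qfac p j > 0"
    using p by (intro qfac_pos) simp
  have "p ^ Suc 1 \<le> p ^ Suc j"
    using p j by (intro power_increasing) auto
  moreover have "p ^ Suc 1 \<ge> 4"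
    using mult_mono[OF p p] p by simp
  ultimately have "p ^ Suc j - 1 \<ge> 2"
    by linarith
  hence "qfac p j * 2 \<le> qfac p (Suc j)"
    using q unfolding qfac_Suc by (intro mult_left_mono) auto
  thus "norm (1 / qfac p (Suc j)) \<le> 1 / 2 * norm (1 / qfac p j)"
    using q by (simp add: field_simps del: qfac_Suc)
qed simp

lemma summable_euler:
  assumes p: "p \<ge> 2" and z: "\<bar>z\<bar> \<le> 1"
  shows "summable (\<lambda>j. (- z) ^ j / qfac p j)"
proof (rule summable_comparison_test'[OF summable_inverse_qfac[OF p], of 0])
  fix j
  have "qfac p j > 0"
    using p by (intro qfac_pos) simp
  moreover have "\<bar>z\<bar> ^ j \<le> 1"
    using z by (intro power_le_one) auto
  ultimately show "norm ((- z) ^ j / qfac p j) \<le> 1 / qfac p j"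
    by (simp add: power_abs divide_right_mono)
qed

text \<open>
  The functional equation of the product, checked coefficientwise.
\<close>

lemma euler_sum_step:
  assumes p: "p \<ge> 2" and z: "\<bar>p * z\<bar> \<le> 1"
  shows "euler_sum p (p * z) = (1 - z) * euler_sum p z"
proof -
  have z': "\<bar>z\<bar> \<le> 1"
  proof -
    have "1 * \<bar>z\<bar> \<le> p * \<bar>z\<bar>"
      using p by (intro mult_right_mono) auto
    thus ?thesis using z p by (simp add: abs_mult)
  qed
  note s1 = summable_euler[OF p z] and s2 = summable_euler[OF p z']
  have step: "(- (p * z)) ^ Suc j / qfac p (Suc j) - (- z) ^ Suc j / qfac p (Suc j) = - z * ((- z) ^ j / qfac p j)" for j
  proof -
    have q: "qfac p j \<noteq> 0" "p ^ Suc j - 1 \<noteq> 0"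
      using qfac_pos[of p j] one_less_power[of p "Suc j"] p by auto
    have "(- (p * z)) ^ Suc j = p ^ Suc j * (- z) ^ Suc j"
      by (metis mult_minus_right power_mult_distrib)
    hence "(- (p * z)) ^ Suc j / qfac p (Suc j) - (- z) ^ Suc j / qfac p (Suc j)
        = (- z) ^ Suc j * (p ^ Suc j - 1) / (qfac p j * (p ^ Suc j - 1))"
      by (simp only: qfac_Suc diff_divide_distrib[symmetric]) (simp add: algebra_simps)
    also have "\<dots> = (- z) ^ Suc j / qfac p j"
      using q(2) by (simp del: power_Suc)
    finally show ?thesis by simp
  qed
  have "euler_sum p (p * z) - euler_sum p z = (\<Sum>j. (- (p * z)) ^ j / qfac p j - (- z) ^ j / qfac p j)"
    unfolding euler_sum_def by (rule suminf_diff[OF s1 s2])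
  also have "\<dots> = (\<Sum>j. (- (p * z)) ^ Suc j / qfac p (Suc j) - (- z) ^ Suc j / qfac p (Suc j))"
    using suminf_split_head[OF summable_diff[OF s1 s2]] by simp
  also have "\<dots> = (\<Sum>j. - z * ((- z) ^ j / qfac p j))"
    by (simp only: step)
  also have "\<dots> = - z * euler_sum p z"
    unfolding euler_sum_def by (rule suminf_mult[OF s2])
  finally show ?thesis
    by (simp add: algebra_simps)
qed

text \<open>
  The functional equation at \<open>z = 1 / p ^ t\<close>, iterated down to \<open>t = 0\<close>.
\<close>

lemma euler_sum_power:
  assumes p: "p \<ge> 2"
  shows "euler_sum p (1 / p ^ t) * (\<Prod>j=1..t. 1 - 1 / p ^ j) = euler_sum p 1"
proof (induction t)
  case (Suc t)
  have "euler_sum p (p * (1 / p ^ Suc t)) = (1 - 1 / p ^ Suc t) * euler_sum p (1 / p ^ Suc t)"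
    using p by (intro euler_sum_step) auto
  moreover have "p * (1 / p ^ Suc t) = 1 / p ^ t"
    using p by simp
  ultimately show ?case
    using Suc.IH by (simp add: mult_ac)
qed simp

lemma euler_sum_tendsto:
  assumes p: "p \<ge> 2"
  shows "(\<lambda>t. euler_sum p (1 / p ^ t)) \<longlonglongrightarrow> 1"
proof -
  define C where "C = (\<Sum>j. 1 / qfac p (Suc j))"
  have sC: "summable (\<lambda>j. 1 / qfac p (Suc j))"
    using summable_inverse_qfac[OF p] by (subst summable_Suc_iff)
  have bound: "norm (euler_sum p z - 1) \<le> norm z * C" if z: "\<bar>z\<bar> \<le> 1" for z
  proof -
    note s = summable_euler[OF p z]
    have le: "norm ((- z) ^ Suc j / qfac p (Suc j)) \<le> norm z * (1 / qfac p (Suc j))" for j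
    proof -
      have "qfac p (Suc j) > 0"
        using p by (intro qfac_pos) simp
      moreover have "\<bar>z\<bar> ^ j \<le> 1"
        using z by (intro power_le_one) auto
      hence "\<bar>z\<bar> * \<bar>z\<bar> ^ j \<le> \<bar>z\<bar> * 1"
        by (intro mult_left_mono) auto
      ultimately show ?thesis
        by (simp add: abs_mult power_abs divide_right_mono del: qfac_Suc)
    qed
    have "euler_sum p z - 1 = (\<Sum>j. (- z) ^ Suc j / qfac p (Suc j))"
      unfolding euler_sum_def using suminf_split_head[OF s] by simp
    also have "norm \<dots> \<le> (\<Sum>j. norm z * (1 / qfac p (Suc j)))"
      by (rule norm_suminf_le[OF le summable_mult[OF sC]])
    also have "\<dots> = norm z * C"
      unfolding C_def by (rule suminf_mult[OF sC])
    finally show ?thesis .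
  qed
  have lim: "(\<lambda>t. 1 / p ^ t * C) \<longlonglongrightarrow> 0 * C"
  proof (intro tendsto_mult tendsto_const)
    show "(\<lambda>t. 1 / p ^ t) \<longlonglongrightarrow> 0"
      using p LIMSEQ_realpow_zero[of "1 / p"] by (simp add: power_one_over)
  qed
  have near: "norm (euler_sum p (1 / p ^ t) - 1) \<le> 1 / p ^ t * C" for t
  proof -
    have "1 \<le> p ^ t"
      using p by (intro one_le_power) simp
    thus ?thesis
      using bound[of "1 / p ^ t"] p by simp
  qed
  have "(\<lambda>t. euler_sum p (1 / p ^ t) - 1) \<longlonglongrightarrow> 0"
    by (rule Lim_null_comparison[rotated, OF lim[unfolded mult_zero_left]])
       (intro always_eventually allI near)
  thus ?thesis
    by (simp add: LIM_zero_iff)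
qed

text \<open>
  As \<open>t\<close> grows in \<open>euler_sum_power\<close>, the series tends to \<open>1\<close> and the finite products to the
  infinite one.
\<close>

lemma euler_sum_1:
  assumes p: "p \<ge> 2"
  shows "euler_sum p 1 = (\<Prod>j. 1 - 1 / p ^ Suc j)"
proof -
  have "summable (\<lambda>j. norm (- (1 / p ^ Suc j)))"
    using p summable_geometric[of "1 / p"] summable_Suc_iff[of "\<lambda>j. (1 / p) ^ j"]
    by (simp add: power_one_over)
  hence "abs_convergent_prod (\<lambda>j. 1 + (- (1 / p ^ Suc j)))"
    by (simp add: abs_convergent_prod_conv_summable)
  hence "convergent_prod (\<lambda>j. 1 - 1 / p ^ Suc j)"
    using abs_convergent_prod_imp_convergent_prod by fastforce
  hence "(\<lambda>n. \<Prod>i\<le>n. 1 - 1 / p ^ Suc i) \<longlonglongrightarrow> (\<Prod>j. 1 - 1 / p ^ Suc j)"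
    by (rule convergent_prod_LIMSEQ)
  hence "(\<lambda>n. euler_sum p (1 / p ^ Suc n) * (\<Prod>i\<le>n. 1 - 1 / p ^ Suc i)) \<longlonglongrightarrow> 1 * (\<Prod>j. 1 - 1 / p ^ Suc j)"
    by (intro tendsto_mult LIMSEQ_Suc[OF euler_sum_tendsto[OF p]])
  also have "(\<lambda>n. euler_sum p (1 / p ^ Suc n) * (\<Prod>i\<le>n. 1 - 1 / p ^ Suc i)) = (\<lambda>n. euler_sum p 1)"
  proof
    fix n
    show "euler_sum p (1 / p ^ Suc n) * (\<Prod>i\<le>n. 1 - 1 / p ^ Suc i) = euler_sum p 1"
      using euler_sum_power[OF p, of "Suc n"]
      by (simp only: One_nat_def prod.atLeast1_atMost_eq lessThan_Suc_atMost)
  qed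
  finally have "euler_sum p 1 = 1 * (\<Prod>j. 1 - 1 / p ^ Suc j)"
    by (rule LIMSEQ_unique[OF tendsto_const])
  thus ?thesis
    by (simp only: mult_1)
qed

lemma gl_order_eq:
  assumes p: "p \<noteq> 0"
  shows "gl_order p k = p ^ (k * k) * (\<Prod>j=1..k. 1 - 1 / p ^ j)"
proof -
  have "gl_order p k = (\<Prod>i<k. p ^ k * (1 - 1 / p ^ (k - i)))"
    unfolding gl_order_def
  proof (intro prod.cong refl)
    fix i assume "i \<in> {..<k}"
    hence "p ^ k = p ^ i * p ^ (k - i)"
      by (simp flip: power_add)
    hence "p ^ k / p ^ (k - i) = p ^ i"
      using p by (metis nonzero_mult_div_cancel_right power_not_zero)
    thus "p ^ k - p ^ i = p ^ k * (1 - 1 / p ^ (k - i))"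
      unfolding right_diff_distrib by simp
  qed
  also have "\<dots> = p ^ (k * k) * (\<Prod>i<k. 1 - 1 / p ^ (k - i))"
    by (simp add: prod.distrib power_mult)
  also have "(\<Prod>i<k. 1 - 1 / p ^ (k - i)) = (\<Prod>j=1..k. 1 - 1 / p ^ j)"
    by (rule prod.reindex_bij_witness[of _ "\<lambda>j. k - j" "\<lambda>i. k - i"]) auto
  finally show ?thesis .
qed

text \<open>
  The series is Euler's at \<open>z = 1 / p ^ (k + u)\<close>, and \<open>gl_order_eq\<close> supplies the factor
  \<open>p ^ (- k\<^sup>2)\<close>.
\<close>

lemma inversion_sums:
  assumes p: "p \<ge> 2"
  shows "(\<lambda>j. inv_coeff p k j / p ^ (u * (k + j))) sums
    (1 / p ^ (k * (k + u)) * ((\<Prod>j. 1 - 1 / p ^ Suc j) / ((\<Prod>j=1..k. 1 - 1 / p ^ j) * (\<Prod>j=1..k + u. 1 - 1 / p ^ j))))"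
proof -
  let ?z = "1 / p ^ (k + u)"
  have prod_pos_1: "(\<Prod>j=1..t. 1 - 1 / p ^ j) > 0" for t
    using p by (intro prod_pos) (auto simp: one_less_power)
  have z: "\<bar>?z\<bar> \<le> 1"
    using p by (simp add: one_le_power)
  have "(\<lambda>j. 1 / (gl_order p k * p ^ (u * k)) * ((- ?z) ^ j / qfac p j)) sums
      (1 / (gl_order p k * p ^ (u * k)) * euler_sum p ?z)"
    unfolding euler_sum_def by (intro sums_mult summable_sums summable_euler p z)
  also have "(\<lambda>j. 1 / (gl_order p k * p ^ (u * k)) * ((- ?z) ^ j / qfac p j))
      = (\<lambda>j. inv_coeff p k j / p ^ (u * (k + j)))"
  proof
    fix j
    have "(- ?z) ^ j = (- 1) ^ j / (p ^ (k * j) * p ^ (u * j))"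
      by (subst power_minus) (simp add: power_divide power_mult[symmetric] power_add[symmetric] algebra_simps)
    thus "1 / (gl_order p k * p ^ (u * k)) * ((- ?z) ^ j / qfac p j) = inv_coeff p k j / p ^ (u * (k + j))"
      by (simp add: inv_coeff_def power_add distrib_left mult_ac)
  qed
  also have "euler_sum p ?z = (\<Prod>j. 1 - 1 / p ^ Suc j) / (\<Prod>j=1..k + u. 1 - 1 / p ^ j)"
    unfolding euler_sum_1[OF p, symmetric] euler_sum_power[OF p, of "k + u", symmetric]
    using prod_pos_1[of "k + u"] by (intro nonzero_mult_div_cancel_right[symmetric]) linarith
  also have "1 / (gl_order p k * p ^ (u * k)) * ((\<Prod>j. 1 - 1 / p ^ Suc j) / (\<Prod>j=1..k + u. 1 - 1 / p ^ j))
     = 1 / p ^ (k * (k + u)) * ((\<Prod>j. 1 - 1 / p ^ Suc j) / ((\<Prod>j=1..k. 1 - 1 / p ^ j) * (\<Prod>j=1..k + u. 1 - 1 / p ^ j)))"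
    using p by (simp add: gl_order_eq power_add distrib_left mult_ac)
  finally show ?thesis .
qed

section \<open>Convergence of the rank distribution\<close>

context random_matrix
begin

definition corank_prob :: "real \<Rightarrow> nat \<Rightarrow> real" where
  "corank_prob s k = \<P>(\<omega> in M. low_weight_free s (A \<omega>) \<and> n - vec_space.rank n (A \<omega>) = k)"

lemma corank_prob_bounds:
  shows "even J \<Longrightarrow> corank_prob s k \<le> (\<Sum>j\<le>J. inv_coeff p k j * restricted_moment s (k + j))"
    and "odd J \<Longrightarrow> (\<Sum>j\<le>J. inv_coeff p k j * restricted_moment s (k + j)) \<le> corank_prob s k"
proof -
  have p: "p > 1"
    using p_ge_2 by simp
  define F where "F = (\<lambda>\<omega>. \<Sum>j\<le>J. inv_coeff p k j *
    (of_bool (low_weight_free s (A \<omega>)) * (\<Prod>i<k + j. real (card (left_kernel (A \<omega>))) - p ^ i)))"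
  define I where "I = (\<lambda>\<omega>. of_bool (low_weight_free s (A \<omega>) \<and> n - vec_space.rank n (A \<omega>) = k) :: real)"
  have EF: "expectation F = (\<Sum>j\<le>J. inv_coeff p k j * restricted_moment s (k + j))"
    unfolding F_def restricted_moment_def
    by (subst Bochner_Integration.integral_sum, rule integrable_mult_right, rule integrable_matrix_function)
       simp
  have EI: "expectation I = corank_prob s k"
    unfolding I_def corank_prob_def by (rule expectation_of_bool)
  have int: "integrable M F" "integrable M I"
    unfolding F_def I_def by (rule integrable_matrix_function)+
  have F: "F \<omega> = of_bool (low_weight_free s (A \<omega>)) *
      (\<Sum>j\<le>J. inv_coeff p k j * (\<Prod>i<k + j. p ^ (n - vec_space.rank n (A \<omega>)) - p ^ i))"
    if "\<omega> \<in> space M" for \<omega>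
  proof -
    have "real (card (left_kernel (A \<omega>))) = p ^ (n - vec_space.rank n (A \<omega>))"
      using left_kernel_rank_nullity(2)[OF A_carrier[OF that]] by (simp add: p_eq)
    thus ?thesis
      by (simp add: F_def sum_distrib_left mult_ac)
  qed
  show "corank_prob s k \<le> (\<Sum>j\<le>J. inv_coeff p k j * restricted_moment s (k + j))" if "even J"
    unfolding EF[symmetric] EI[symmetric]
  proof (rule integral_mono[OF int(2,1)])
    fix \<omega> assume "\<omega> \<in> space M"
    show "I \<omega> \<le> F \<omega>"
      unfolding F[OF \<open>\<omega> \<in> space M\<close>] I_def of_bool_conj
      by (intro mult_left_mono inversion_bounds(1)[OF p that]) simp
  qed
  show "(\<Sum>j\<le>J. inv_coeff p k j * restricted_moment s (k + j)) \<le> corank_prob s k" if "odd J"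
    unfolding EF[symmetric] EI[symmetric]
  proof (rule integral_mono[OF int])
    fix \<omega> assume "\<omega> \<in> space M"
    show "F \<omega> \<le> I \<omega>"
      unfolding F[OF \<open>\<omega> \<in> space M\<close>] I_def of_bool_conj
      by (intro mult_left_mono inversion_bounds(2)[OF p that]) simp
  qed
qed

text \<open>
  The two events differ only where the kernel contains a nonzero low-weight vector.
\<close>

lemma prob_corank_near:
  assumes "s > 0"
  shows "\<bar>\<P>(\<omega> in M. int (vec_space.rank n (A \<omega>)) = int n - int k) - corank_prob s k\<bar>
    \<le> exp (p * (\<Sum>i<nc. exp (- c * \<beta> i * s))) * low_weight_mass s"
proof -
  let ?D = "{\<omega> \<in> space M. n - vec_space.rank n (A \<omega>) = k}"
  let ?C = "{\<omega> \<in> space M. low_weight_free s (A \<omega>) \<and> n - vec_space.rank n (A \<omega>) = k}"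
  let ?N = "{\<omega> \<in> space M. \<not> low_weight_free s (A \<omega>)}"
  have sets: "?D \<in> events" "?C \<in> events" "?N \<in> events"
    by (rule sets_matrix_event)+
  have "{\<omega> \<in> space M. int (vec_space.rank n (A \<omega>)) = int n - int k} = ?D"
    using left_kernel_rank_nullity(1)[OF A_carrier] by force
  moreover have "prob ?C \<le> prob ?D"
    using sets by (intro finite_measure_mono) auto
  moreover have "prob ?D \<le> prob (?C \<union> ?N)"
    using sets by (intro finite_measure_mono) auto
  moreover have "prob (?C \<union> ?N) \<le> prob ?C + prob ?N"
    by (rule measure_Un_le) (rule sets)+
  moreover have "prob ?N \<le> exp (p * (\<Sum>i<nc. exp (- c * \<beta> i * s))) * low_weight_mass s"
    by (rule prob_low_weight_in_kernel_le[OF assms])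
  ultimately show ?thesis
    by (simp add: corank_prob_def)
qed

end

text \<open>
  Every truncation \<open>J\<close> gives a one-sided bound for the limit in \<open>n\<close>; \<open>J\<close> is sent to infinity
  only afterwards.
\<close>

lemma tendsto_alternating_bounds:
  fixes U :: "nat \<Rightarrow> nat \<Rightarrow> real"
  assumes U: "\<And>J. (\<lambda>n. U J n) \<longlonglongrightarrow> L J" and L: "L \<longlonglongrightarrow> l"
    and le: "\<And>J. even J \<Longrightarrow> \<forall>\<^sub>F n in sequentially. q n \<le> U J n"
    and ge: "\<And>J. odd J \<Longrightarrow> \<forall>\<^sub>F n in sequentially. U J n \<le> q n"
  shows "q \<longlonglongrightarrow> l"
proof (rule order_tendstoI)
  fix a assume "l < a"
  with L have "\<forall>\<^sub>F J in sequentially. L J < a"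
    by (rule order_tendstoD)
  then obtain J0 where "\<And>J. J \<ge> J0 \<Longrightarrow> L J < a"
    by (auto simp: eventually_sequentially)
  hence "L (2 * J0) < a"
    by simp
  with U have "\<forall>\<^sub>F n in sequentially. U (2 * J0) n < a"
    by (rule order_tendstoD)
  moreover have "\<forall>\<^sub>F n in sequentially. q n \<le> U (2 * J0) n"
    by (rule le) simp
  ultimately show "\<forall>\<^sub>F n in sequentially. q n < a"
    by (rule eventually_elim2) simp
next
  fix a assume "a < l"
  with L have "\<forall>\<^sub>F J in sequentially. a < L J"
    by (rule order_tendstoD)
  then obtain J0 where "\<And>J. J \<ge> J0 \<Longrightarrow> a < L J"
    by (auto simp: eventually_sequentially)
  hence "a < L (2 * J0 + 1)"
    by simp
  with U have "\<forall>\<^sub>F n in sequentially. a < U (2 * J0 + 1) n"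
    by (rule order_tendstoD)
  moreover have "\<forall>\<^sub>F n in sequentially. U (2 * J0 + 1) n \<le> q n"
    by (rule ge) simp
  ultimately show "\<forall>\<^sub>F n in sequentially. a < q n"
    by (rule eventually_elim2) simp
qed

lemma exp_neg_linear_tendsto_0:
  assumes "a < (0 :: real)"
  shows "(\<lambda>n. exp (a * real n)) \<longlonglongrightarrow> 0"
proof -
  have "exp (a * real n) = exp a ^ n" for n
    by (simp add: exp_of_nat2_mult)
  thus ?thesis
    using LIMSEQ_realpow_zero[of "exp a"] assms by simp
qed

text \<open>
  The count is at most \<open>exp (3 n / 32)\<close>, and \<open>exp (3 / 32) < 2 \<le> p\<close>.
\<close>

lemma low_weight_fraction_tendsto_0:
  "(\<lambda>n. real (card (low_weight n (2 * (low_density (real CARD('p)) * real n)) :: (nat \<Rightarrow> 'p::prime_card mod_ring) set))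
    / real CARD('p) ^ n) \<longlonglongrightarrow> 0"
proof (rule tendsto_sandwich[OF _ _ tendsto_const])
  define e where "e = exp (3 / 32 :: real) / 2"
  have "1 + - (3 / 32 :: real) \<le> exp (- (3 / 32))"
    by (rule exp_ge_add_one_self)
  hence "29 / 32 * exp (3 / 32 :: real) \<le> exp (- (3 / 32)) * exp (3 / 32)"
    by (intro mult_right_mono) auto
  also have "\<dots> = 1"
    by (simp flip: exp_add)
  finally have e: "0 \<le> e" "e < 1"
    by (auto simp: e_def)
  show "(\<lambda>n. e ^ n) \<longlonglongrightarrow> 0"
    by (rule LIMSEQ_realpow_zero[OF e])
  show "\<forall>\<^sub>F n in sequentially. real (card (low_weight n (2 * (low_density (real CARD('p)) * real n)) :: (nat \<Rightarrow> 'p mod_ring) set))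
      / real CARD('p) ^ n \<le> e ^ n"
  proof (intro always_eventually allI)
    fix n
    have "real (card (low_weight n (2 * (low_density (real CARD('p)) * real n)) :: (nat \<Rightarrow> 'p mod_ring) set)) / real CARD('p) ^ n
        \<le> exp ((1 + 2) * real n / 32) / 2 ^ n"
      using CARD_ge_2[where 'p = 'p] by (intro frac_le card_low_weight_density_le power_mono) auto
    also have "\<dots> = e ^ n"
      by (simp add: e_def power_divide exp_of_nat_mult[symmetric])
    finally show "real (card (low_weight n (2 * (low_density (real CARD('p)) * real n)) :: (nat \<Rightarrow> 'p mod_ring) set))
      / real CARD('p) ^ n \<le> e ^ n" .
  qed
qed (intro always_eventually allI, simp)

theorem corollary1p4:
  fixes p u k :: nat
    and \<alpha> :: "nat \<Rightarrow> nat \<Rightarrow> real"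
    and M :: "nat \<Rightarrow> 'w measure"
    and A :: "nat \<Rightarrow> 'w \<Rightarrow> 'p::prime_card mod_ring mat"
  assumes "prime p" and "CARD('p) = p"
    and "\<And>n i. n \<ge> 1 \<Longrightarrow> i \<in> {1..n + u} \<Longrightarrow> \<alpha> n i \<in> {0<..1/2}"
    and "\<And>\<epsilon>::real. \<epsilon> > 0 \<Longrightarrow>
           (\<lambda>n. \<Sum>i=1..n + u. exp (- \<epsilon> * \<alpha> n i * real n)) \<longlonglongrightarrow> 0"
    and "\<And>n. n \<ge> 1 \<Longrightarrow> prob_space (M n)"
    and "\<And>n. n \<ge> 1 \<Longrightarrow> indep_entries_mat (M n) n (n + u) (A n)"
    and "\<And>n i. n \<ge> 1 \<Longrightarrow> i \<in> {1..n + u} \<Longrightarrow>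
           balanced_vec (\<alpha> n i) (M n) n (\<lambda>\<omega>. col (A n \<omega>) (i - 1))"
  shows "(\<lambda>n. \<P>(\<omega> in M n. int (vec_space.rank n (A n \<omega>)) = int n - int k)) \<longlonglongrightarrow>
           real p powi (- (int k * (int k + int u))) *
           ((\<Prod>j. 1 - real p powi (- int (Suc j))) /
            ((\<Prod>j=1..k. 1 - real p powi (- int j)) *
             (\<Prod>j=1..k + u. 1 - real p powi (- int j))))"
proof -
  define q where "q = real p"
  define c where "c = char_gap CARD('p)"
  (* The bounds \<alpha> count columns from 1, random_matrix from 0. *)
  define \<beta> where "\<beta> = (\<lambda>n i. \<alpha> n (Suc i))"
  have q: "q \<ge> 2"
    using CARD_ge_2[where 'p = 'p] assms(2) by (simp add: q_def)
  have q_eq: "q = real CARD('p)"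
    by (simp add: q_def assms(2))
  have c: "c > 0"
    unfolding c_def by (rule char_gap_pos[OF CARD_ge_2])
  have rm: "random_matrix (M n) n (n + u) (A n) (\<beta> n) q c" if n: "n \<ge> 1" for n
  proof -
    interpret prob_space "M n" by (rule assms(5)[OF n])
    show ?thesis
    proof
      show "q = real CARD('p)" "c = char_gap CARD('p)"
        by (simp_all add: q_eq c_def)
      show ind: "indep_entries_mat (M n) n (n + u) (A n)"
        by (rule assms(6)[OF n])
      fix i assume i: "i < n + u"
      hence "Suc i \<in> {1..n + u}"
        by simp
      with assms(3)[OF n this] show "\<beta> n i \<ge> 0"
        by (simp add: \<beta>_def)
      fix j assume j: "j < n"
      have "balanced (\<alpha> n (Suc i)) (M n) (\<lambda>\<omega>. col (A n \<omega>) (Suc i - 1) $ j)"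
        using assms(7)[OF n \<open>Suc i \<in> _\<close>] j by (simp add: balanced_vec_def)
      moreover have eq: "col (A n \<omega>) (Suc i - 1) $ j = A n \<omega> $$ (j, i)" if "\<omega> \<in> space (M n)" for \<omega>
        using ind that i j by (auto simp: indep_entries_mat_def)
      moreover have "balanced (\<alpha> n (Suc i)) (M n) (\<lambda>\<omega>. col (A n \<omega>) (Suc i - 1) $ j)
          \<longleftrightarrow> balanced (\<alpha> n (Suc i)) (M n) (\<lambda>\<omega>. A n \<omega> $$ (j, i))"
        unfolding balanced_def using eq
        by (intro conj_cong measurable_cong all_cong1) (auto cong: conj_cong)
      ultimately show "balanced (\<beta> n i) (M n) (\<lambda>\<omega>. A n \<omega> $$ (j, i))"
        by (simp add: \<beta>_def)
    qed
  qed
  define s where "s = (\<lambda>n. low_density q * real n)"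
  have d: "low_density q > 0"
    by (rule low_density_pos[OF q])
  have s: "s n > 0" if "n \<ge> 1" for n
    using d that by (simp add: s_def)
  have hyp: "(\<lambda>n. \<Sum>i<n + u. exp (- \<epsilon> * \<beta> n i * real n)) \<longlonglongrightarrow> 0" if "\<epsilon> > 0" for \<epsilon>
    using assms(4)[OF that] by (simp only: \<beta>_def One_nat_def sum.atLeast1_atMost_eq)
  define \<eta> where "\<eta> = (\<lambda>n. \<Sum>i<n + u. exp (- c * \<beta> n i * s n))"
  have eta: "\<eta> \<longlonglongrightarrow> 0"
    using hyp[of "c * low_density q"] c d by (simp add: \<eta>_def s_def mult_ac)
  define \<tau> where "\<tau> = (\<lambda>n. random_matrix.low_weight_mass TYPE('p) n (n + u) (\<beta> n) q c (s n))"
  define \<mu> where "\<mu> = (\<lambda>m n. random_matrix.restricted_moment (M n) n (A n) q (s n) m)"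
  define \<pi> where "\<pi> = (\<lambda>n. random_matrix.corank_prob (M n) n (A n) (s n) k)"
  have p_eq: "real CARD('p) = q"
    by (simp add: q_eq)
  have ratio: "q ^ (n * m) / q ^ (m * (n + u)) = 1 / q ^ (u * m)" for n m
    using q by (simp add: distrib_left power_add mult.commute)
  have tau_lim: "\<tau> \<longlonglongrightarrow> 0"
  proof (rule tendsto_sandwich[OF _ _ tendsto_const])
    (* exp (n / 16) low-weight vectors, each weighted with exp (- n / 8). *)
    show "(\<lambda>n. (exp (q / real n) - 1) + exp (- (1 / 16) * real n)) \<longlonglongrightarrow> 0"
    proof -
      have "(\<lambda>n. (exp (q / real n) - 1) + exp (- (1 / 16) * real n)) \<longlonglongrightarrow> (exp 0 - 1) + 0"
        by (intro tendsto_intros lim_const_over_n exp_neg_linear_tendsto_0) simp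
      thus ?thesis by simp
    qed
    have "\<forall>\<^sub>F n in sequentially. (\<Sum>i<n + u. exp (- (c / 16) * \<beta> n i * real n)) < 1 / 2"
      using c by (intro order_tendstoD(2)[OF hyp]) auto
    thus "\<forall>\<^sub>F n in sequentially. \<tau> n \<le> (exp (q / real n) - 1) + exp (- (1 / 16) * real n)"
      using eventually_ge_at_top[of 1]
    proof eventually_elim
      case (elim n)
      have "\<tau> n \<le> (exp (q / n) - 1) + card (low_weight n (s n) :: (nat \<Rightarrow> 'p mod_ring) set) * exp (- real n / 8)"
        unfolding \<tau>_def
        by (rule random_matrix.low_weight_mass_le[OF rm[OF elim(2)] elim(2)], rule many_heavy_columns[OF elim(2) _ c elim(1)]) simp
      also have "real (card (low_weight n (s n) :: (nat \<Rightarrow> 'p mod_ring) set)) * exp (- real n / 8) \<le> exp (real n / 16) * exp (- real n / 8)"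
        using card_low_weight_density_le[of 1 n, where 'p = 'p] by (intro mult_right_mono) (auto simp: s_def p_eq)
      also have "\<dots> = exp (- (1 / 16) * real n)"
        by (simp flip: exp_add)
      finally show ?case by simp
    qed
    show "\<forall>\<^sub>F n in sequentially. 0 \<le> \<tau> n"
      using eventually_ge_at_top[of 1]
    proof eventually_elim
      case (elim n)
      show ?case
        unfolding \<tau>_def random_matrix.low_weight_mass_def[OF rm[OF elim]]
        using q by (intro sum_nonneg prod_nonneg add_nonneg_nonneg mult_nonneg_nonneg) auto
    qed
  qed
  have mu: "\<mu> m \<longlonglongrightarrow> 1 / q ^ (u * m)" for m
  proof (rule tendsto_sandwich)
    define l where "l = (\<lambda>n. real (card (low_weight n (2 * s n) :: (nat \<Rightarrow> 'p mod_ring) set)) / q ^ n)"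
    have l: "l \<longlonglongrightarrow> 0"
      unfolding l_def s_def using low_weight_fraction_tendsto_0[where 'p = 'p] by (simp only: p_eq)
    show "\<forall>\<^sub>F n in sequentially. \<mu> m n \<le> 1 / q ^ (u * m) * exp (q ^ m * \<eta> n)"
      using eventually_ge_at_top[of 1]
    proof eventually_elim
      case (elim n)
      show ?case
        using random_matrix.restricted_moment_upper[OF rm[OF elim] s[OF elim], of m] by (simp only: ratio \<mu>_def \<eta>_def)
    qed
    show "\<forall>\<^sub>F n in sequentially. 1 / q ^ (u * m) *
        (1 - m * q ^ m * l n - (exp (q ^ m * \<eta> n) - 1) - exp (q ^ Suc m * \<eta> n) * \<tau> n) \<le> \<mu> m n"
      using eventually_ge_at_top[of 1]
    proof eventually_elim
      case (elim n)
      show ?case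
        using random_matrix.restricted_moment_lower[OF rm[OF elim] s[OF elim], of m]
        by (simp only: ratio \<mu>_def \<eta>_def \<tau>_def l_def)
    qed
    have "(\<lambda>n. 1 / q ^ (u * m) * exp (q ^ m * \<eta> n)) \<longlonglongrightarrow> 1 / q ^ (u * m) * exp (q ^ m * 0)"
      by (intro tendsto_intros eta)
    thus "(\<lambda>n. 1 / q ^ (u * m) * exp (q ^ m * \<eta> n)) \<longlonglongrightarrow> 1 / q ^ (u * m)"
      by simp
    have "(\<lambda>n. 1 / q ^ (u * m) *
        (1 - m * q ^ m * l n - (exp (q ^ m * \<eta> n) - 1) - exp (q ^ Suc m * \<eta> n) * \<tau> n)) \<longlonglongrightarrow>
        1 / q ^ (u * m) * (1 - m * q ^ m * 0 - (exp (q ^ m * 0) - 1) - exp (q ^ Suc m * 0) * 0)"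
      by (intro tendsto_intros eta l tau_lim)
    thus "(\<lambda>n. 1 / q ^ (u * m) *
        (1 - m * q ^ m * l n - (exp (q ^ m * \<eta> n) - 1) - exp (q ^ Suc m * \<eta> n) * \<tau> n)) \<longlonglongrightarrow> 1 / q ^ (u * m)"
      by simp
  qed
  define target where "target = 1 / q ^ (k * (k + u)) * ((\<Prod>j. 1 - 1 / q ^ Suc j) /
    ((\<Prod>j=1..k. 1 - 1 / q ^ j) * (\<Prod>j=1..k + u. 1 - 1 / q ^ j)))"
  have pi_lim: "\<pi> \<longlonglongrightarrow> target"
  proof (rule tendsto_alternating_bounds)
    show "(\<lambda>n. \<Sum>j\<le>J. inv_coeff q k j * \<mu> (k + j) n) \<longlonglongrightarrow> (\<Sum>j\<le>J. inv_coeff q k j * (1 / q ^ (u * (k + j))))" for J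
      by (intro tendsto_intros mu)
    show "(\<lambda>J. \<Sum>j\<le>J. inv_coeff q k j * (1 / q ^ (u * (k + j)))) \<longlonglongrightarrow> target"
      using inversion_sums[OF q, of k u] by (simp add: sums_def_le target_def)
    show "\<forall>\<^sub>F n in sequentially. \<pi> n \<le> (\<Sum>j\<le>J. inv_coeff q k j * \<mu> (k + j) n)" if "even J" for J
      using eventually_ge_at_top[of 1]
    proof eventually_elim
      case (elim n)
      show ?case
        using random_matrix.corank_prob_bounds(1)[OF rm[OF elim] that] by (simp only: \<pi>_def \<mu>_def)
    qed
    show "\<forall>\<^sub>F n in sequentially. (\<Sum>j\<le>J. inv_coeff q k j * \<mu> (k + j) n) \<le> \<pi> n" if "odd J" for J
      using eventually_ge_at_top[of 1]
    proof eventually_elim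
      case (elim n)
      show ?case
        using random_matrix.corank_prob_bounds(2)[OF rm[OF elim] that] by (simp only: \<pi>_def \<mu>_def)
    qed
  qed
  have "(\<lambda>n. \<P>(\<omega> in M n. int (vec_space.rank n (A n \<omega>)) = int n - int k) - \<pi> n) \<longlonglongrightarrow> 0"
  proof (rule Lim_null_comparison)
    show "\<forall>\<^sub>F n in sequentially. norm (\<P>(\<omega> in M n. int (vec_space.rank n (A n \<omega>)) = int n - int k) - \<pi> n)
        \<le> exp (q * \<eta> n) * \<tau> n"
      using eventually_ge_at_top[of 1]
    proof eventually_elim
      case (elim n)
      show ?case
        using random_matrix.prob_corank_near[OF rm[OF elim] s[OF elim]]
        by (simp only: \<pi>_def \<eta>_def \<tau>_def real_norm_def)
    qed
    have "(\<lambda>n. exp (q * \<eta> n) * \<tau> n) \<longlonglongrightarrow> exp (q * 0) * 0"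
      by (intro tendsto_intros eta tau_lim)
    thus "(\<lambda>n. exp (q * \<eta> n) * \<tau> n) \<longlonglongrightarrow> 0"
      by simp
  qed
  from tendsto_add[OF this pi_lim]
  have "(\<lambda>n. \<P>(\<omega> in M n. int (vec_space.rank n (A n \<omega>)) = int n - int k)) \<longlonglongrightarrow> target"
    by simp
  also have "target = real p powi (- (int k * (int k + int u))) *
           ((\<Prod>j. 1 - real p powi (- int (Suc j))) /
            ((\<Prod>j=1..k. 1 - real p powi (- int j)) *
             (\<Prod>j=1..k + u. 1 - real p powi (- int j))))"
  proof -
    have powi: "real p powi (- int m) = 1 / q ^ m" for m
      by (simp add: q_def power_int_minus inverse_eq_divide)
    have "int k * (int k + int u) = int (k * (k + u))"
      by simp
    thus ?thesis
      by (simp only: target_def powi)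
  qed
  finally show ?thesis .
qed

end
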